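(* Let $A$ be an operator algebra with a right contractive approximate identity $\{e_\alpha\}$. Let $(\mathcal{T}(A), i)$ be a triple envelope of $A$, and let $\mathcal{E}(A) = \mathcal{T}(A)\mathcal{T}(A)^*$. Then the map $\psi : \mathcal{T}(A) \to \mathcal{E}(A)$ given by $\psi(x) := \lim_\alpha x\, i(e_\alpha)^*$ is a well defined complete isometry, and $j := \psi \circ i : A \to \mathcal{E}(A)$ is a homomorphism. The range $J$ of $\psi$ is a left ideal of the $C^*$-algebra $\mathcal{E}(A)$, and $\psi$ is also a triple morphism onto $J$. Thus $(J, j)$ is another triple envelope of $A$. Moreover $J J^* = \mathcal{E}(A)$, and any right contractive approximate identity for $A$ is taken by $j$ to a right contractive approximate identity for $J$. Finally, $\psi(x)\psi(y)^* = x y^*$ for all $x, y \in \mathcal{T}(A)$.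
   Context: An operator algebra is an algebra $A$ with norms on all $M_n(A)$ such that there is a completely isometric homomorphism $A \to B(H)$ for some Hilbert space $H$; all operator algebras and operator spaces are complete. A right contractive approximate identity of $A$ is a net $\{e_\alpha\}$ in $A$ with $\|e_\alpha\|\le 1$ and $a e_\alpha \to a$ in norm for all $a \in A$. For subsets $X,Y$ of an operator algebra, $XY$ denotes the norm closure of the set of finite sums of products $xy$, $x\in X$, $y \in Y$ (similarly for more factors). "Left ideal" means norm closed left ideal. A triple system is a norm closed subspace $X$ of a $C^*$-algebra with $XX^*X \subset X$ (off-diagonal corners such as $B(K,H)$ are allowed). A triple subspace is a norm closed subspace closed under the triple product $x y^* z$. A linear map $T: X \to Y$ between triple systems is a triple morphism if $T(xy^*z) = T(x)T(y)^*T(z)$ for all $x,y,z$. For a triple system $X$, $XX^*$ is a $C^*$-algebra, called the left $C^*$-algebra of $X$. A triple envelope (Hamana) of an operator space $X$ is a pair $(\mathcal{T}(X), i)$ with $\mathcal{T}(X)$ a triple system and $i : X \to \mathcal{T}(X)$ a linear complete isometry such that no proper triple subspace of $\mathcal{T}(X)$ contains $i(X)$, and with the universal property: for any triple system $Z$ and linear complete isometry $k : X \to Z$ such that no proper triple subspace of $Z$ contains $k(X)$, there is a (necessarily unique and surjective) triple morphism $\theta : Z \to \mathcal{T}(X)$ with $\theta\circ k = i$. It exists and is essentially unique. *)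

theory Defs
  imports "HOL-Analysis.Analysis"
begin

section \<open>Complex vector spaces, algebras and Hilbert spaces\<close>

class scaleC =
  fixes scaleC :: "complex \<Rightarrow> 'a \<Rightarrow> 'a" (infixr "*\<^sub>C" 75)

class complex_vector = scaleC + ab_group_add +
  assumes scaleC_add_right: "c *\<^sub>C (x + y) = c *\<^sub>C x + c *\<^sub>C y"
    and scaleC_add_left: "(c + d) *\<^sub>C x = c *\<^sub>C x + d *\<^sub>C x"
    and scaleC_scaleC: "c *\<^sub>C (d *\<^sub>C x) = (c * d) *\<^sub>C x"
    and scaleC_one: "1 *\<^sub>C x = x"

text \<open>Algebras need not be unital: \<^class>\<open>ring\<close> does not provide a unit.\<close>

class complex_algebra = complex_vector + ring +
  assumes mult_scaleC_left: "(c *\<^sub>C a) * b = c *\<^sub>C (a * b)"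
    and mult_scaleC_right: "a * (c *\<^sub>C b) = c *\<^sub>C (a * b)"

text \<open>The complex inner product is linear in the first argument; its real part is the
  library's real inner product, so that norm and topology are those of the library.\<close>

class complex_inner = complex_vector + real_inner +
  fixes cinner :: "'a \<Rightarrow> 'a \<Rightarrow> complex"
  assumes scaleR_scaleC: "r *\<^sub>R x = complex_of_real r *\<^sub>C x"
    and inner_eq_Re_cinner: "inner x y = Re (cinner x y)"
    and cinner_commute: "cinner x y = cnj (cinner y x)"
    and cinner_add_left: "cinner (x + y) z = cinner x z + cinner y z"
    and cinner_scaleC_left: "cinner (c *\<^sub>C x) y = c * cinner x y"

class chilbert = complex_inner + complete_space

abbreviation csubspace :: "'a::complex_vector set \<Rightarrow> bool" where
  "csubspace \<equiv> module.subspace scaleC"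

definition clinear_on :: "'a::complex_vector set \<Rightarrow> ('a \<Rightarrow> 'b::complex_vector) \<Rightarrow> bool" where
  "clinear_on X f \<longleftrightarrow>
     (\<forall>x\<in>X. \<forall>y\<in>X. f (x + y) = f x + f y) \<and> (\<forall>c. \<forall>x\<in>X. f (c *\<^sub>C x) = c *\<^sub>C f x)"

lemma norm_scaleC: "norm (c *\<^sub>C x) = cmod c * norm (x::'a::complex_inner)"
proof -
  have sq: "(norm y)\<^sup>2 = Re (cinner y y)" for y :: 'a
    by (simp add: power2_norm_eq_inner inner_eq_Re_cinner)
  have im: "Im (cinner y y) = 0" for y :: 'a
    using cinner_commute[of y y] by (metis Reals_cnj_iff complex_is_Real_iff)
  have right: "cinner y (c *\<^sub>C z) = cnj c * cinner y z" for y z :: 'a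
    by (metis cinner_commute cinner_scaleC_left complex_cnj_mult)
  have "cinner (c *\<^sub>C x) (c *\<^sub>C x) = (c * cnj c) * cinner x x"
    by (simp add: cinner_scaleC_left right mult.assoc)
  also have "\<dots> = complex_of_real ((cmod c)\<^sup>2) * cinner x x"
    by (simp only: complex_norm_square)
  finally have "(norm (c *\<^sub>C x))\<^sup>2 = (cmod c)\<^sup>2 * (norm x)\<^sup>2"
    by (simp add: sq im)
  then have "(norm (c *\<^sub>C x))\<^sup>2 = (cmod c * norm x)\<^sup>2"
    by (simp add: power_mult_distrib)
  then show ?thesis
    by (simp add: power2_eq_iff_nonneg)
qed

lemma bounded_linear_scaleC: "bounded_linear (\<lambda>x::'a::complex_inner. c *\<^sub>C x)"
proof (rule bounded_linear_intro[where K = "cmod c"])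
  fix x y :: 'a and r :: real
  show "c *\<^sub>C (x + y) = c *\<^sub>C x + c *\<^sub>C y" by (rule scaleC_add_right)
  show "c *\<^sub>C (r *\<^sub>R x) = r *\<^sub>R (c *\<^sub>C x)"
    by (simp add: scaleR_scaleC scaleC_scaleC mult.commute)
  show "norm (c *\<^sub>C x) \<le> norm x * cmod c" by (simp add: norm_scaleC mult.commute)
qed

section \<open>The Hilbert space of square summable families\<close>

typedef 'i ell2 = "{f :: 'i \<Rightarrow> complex. (\<lambda>i. (cmod (f i))\<^sup>2) summable_on UNIV}"
  morphisms ell2_coord Abs_ell2
  by (rule exI[of _ "\<lambda>_. 0"]) simp

setup_lifting type_definition_ell2

lemma ell2_summable_mult:
  fixes f g :: "'i \<Rightarrow> complex"
  assumes "(\<lambda>i. (cmod (f i))\<^sup>2) summable_on UNIV" "(\<lambda>i. (cmod (g i))\<^sup>2) summable_on UNIV"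
  shows "(\<lambda>i. f i * cnj (g i)) summable_on UNIV"
proof -
  have "(\<lambda>i. norm (f i * cnj (g i))) summable_on UNIV"
  proof (rule summable_on_comparison_test)
    show "(\<lambda>i. (cmod (f i))\<^sup>2 + (cmod (g i))\<^sup>2) summable_on UNIV"
      by (intro summable_on_add assms)
    show "norm (f i * cnj (g i)) \<le> (cmod (f i))\<^sup>2 + (cmod (g i))\<^sup>2" for i
    proof -
      have "2 * (cmod (f i) * cmod (g i)) \<le> (cmod (f i))\<^sup>2 + (cmod (g i))\<^sup>2"
        using sum_squares_bound[of "cmod (f i)" "cmod (g i)"] by simp
      moreover have "0 \<le> cmod (f i) * cmod (g i)" by simp
      ultimately show ?thesis unfolding norm_mult complex_mod_cnj by linarith
    qed
  qed auto
  then show ?thesis by (rule abs_summable_summable)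
qed

lemma ell2_summable_add:
  fixes f g :: "'i \<Rightarrow> complex"
  assumes "(\<lambda>i. (cmod (f i))\<^sup>2) summable_on UNIV" "(\<lambda>i. (cmod (g i))\<^sup>2) summable_on UNIV"
  shows "(\<lambda>i. (cmod (f i + g i))\<^sup>2) summable_on UNIV"
proof (rule summable_on_comparison_test)
  show "(\<lambda>i. 2 * (cmod (f i))\<^sup>2 + 2 * (cmod (g i))\<^sup>2) summable_on UNIV"
    by (intro summable_on_add summable_on_cmult_right assms)
  show "(cmod (f i + g i))\<^sup>2 \<le> 2 * (cmod (f i))\<^sup>2 + 2 * (cmod (g i))\<^sup>2" for i
  proof -
    have "(cmod (f i + g i))\<^sup>2 \<le> (cmod (f i) + cmod (g i))\<^sup>2"
      by (intro power_mono norm_triangle_ineq) simp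
    also have "\<dots> \<le> 2 * (cmod (f i))\<^sup>2 + 2 * (cmod (g i))\<^sup>2"
      using sum_squares_bound[of "cmod (f i)" "cmod (g i)"] by (simp add: power2_sum)
    finally show ?thesis .
  qed
qed auto

lemma ell2_summable_scale:
  fixes f :: "'i \<Rightarrow> complex"
  assumes "(\<lambda>i. (cmod (f i))\<^sup>2) summable_on UNIV"
  shows "(\<lambda>i. (cmod (c * f i))\<^sup>2) summable_on UNIV"
  by (simp add: norm_mult power_mult_distrib summable_on_cmult_right assms)

instantiation ell2 :: (type) complex_inner
begin

lift_definition zero_ell2 :: "'a ell2" is "\<lambda>_. 0" by simp
lift_definition plus_ell2 :: "'a ell2 \<Rightarrow> 'a ell2 \<Rightarrow> 'a ell2" is "\<lambda>f g i. f i + g i"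
  by (rule ell2_summable_add)
lift_definition uminus_ell2 :: "'a ell2 \<Rightarrow> 'a ell2" is "\<lambda>f i. - f i" by simp
lift_definition minus_ell2 :: "'a ell2 \<Rightarrow> 'a ell2 \<Rightarrow> 'a ell2" is "\<lambda>f g i. f i - g i"
  subgoal for f g using ell2_summable_add[of f "\<lambda>i. - g i"] by simp
  done
lift_definition scaleC_ell2 :: "complex \<Rightarrow> 'a ell2 \<Rightarrow> 'a ell2" is "\<lambda>c f i. c * f i"
  by (rule ell2_summable_scale)
definition scaleR_ell2 :: "real \<Rightarrow> 'a ell2 \<Rightarrow> 'a ell2" where
  "scaleR_ell2 r x = complex_of_real r *\<^sub>C x"
lift_definition cinner_ell2 :: "'a ell2 \<Rightarrow> 'a ell2 \<Rightarrow> complex"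
  is "\<lambda>f g. \<Sum>\<^sub>\<infinity>i. f i * cnj (g i)" .
definition inner_ell2 :: "'a ell2 \<Rightarrow> 'a ell2 \<Rightarrow> real" where
  "inner_ell2 x y = Re (cinner x y)"
definition norm_ell2 :: "'a ell2 \<Rightarrow> real" where
  "norm_ell2 x = sqrt (inner x x)"
definition sgn_ell2 :: "'a ell2 \<Rightarrow> 'a ell2" where
  "sgn_ell2 x = inverse (norm x) *\<^sub>R x"
definition dist_ell2 :: "'a ell2 \<Rightarrow> 'a ell2 \<Rightarrow> real" where
  "dist_ell2 x y = norm (x - y)"
definition uniformity_ell2 :: "('a ell2 \<times> 'a ell2) filter" where
  "uniformity_ell2 = (INF e\<in>{0<..}. principal {(x, y). dist x y < e})"
definition open_ell2 :: "'a ell2 set \<Rightarrow> bool" where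
  "open_ell2 U \<longleftrightarrow> (\<forall>x\<in>U. eventually (\<lambda>(x', y). x' = x \<longrightarrow> y \<in> U) uniformity)"

instance
proof
  fix x y z :: "'a ell2" and c d :: complex and r s :: real
  show "c *\<^sub>C (x + y) = c *\<^sub>C x + c *\<^sub>C y" by transfer (simp add: distrib_left)
  show "(c + d) *\<^sub>C x = c *\<^sub>C x + d *\<^sub>C x" by transfer (simp add: distrib_right)
  show "c *\<^sub>C d *\<^sub>C x = (c * d) *\<^sub>C x" by transfer (simp add: mult.assoc)
  show "1 *\<^sub>C x = x" by transfer simp
  show "x + y + z = x + (y + z)" by transfer (simp add: add.assoc)
  show "x + y = y + x" by transfer (simp add: add.commute)
  show "0 + x = x" by transfer simp
  show "- x + x = 0" by transfer simp
  show "x - y = x + - y" by transfer simp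
  show "r *\<^sub>R (x + y) = r *\<^sub>R x + r *\<^sub>R y"
    unfolding scaleR_ell2_def by transfer (simp add: distrib_left)
  show "(r + s) *\<^sub>R x = r *\<^sub>R x + s *\<^sub>R x"
    unfolding scaleR_ell2_def by transfer (simp add: distrib_right)
  show "r *\<^sub>R s *\<^sub>R x = (r * s) *\<^sub>R x"
    unfolding scaleR_ell2_def by transfer (simp add: mult.assoc)
  show "1 *\<^sub>R x = x" unfolding scaleR_ell2_def by transfer simp
  show "r *\<^sub>R x = complex_of_real r *\<^sub>C x" by (rule scaleR_ell2_def)
  show "inner x y = Re (cinner x y)" by (rule inner_ell2_def)
  show cc: "cinner x y = cnj (cinner y x)" for x y :: "'a ell2"
    by transfer (simp add: infsum_cnj[symmetric] mult.commute)
  show ca: "cinner (x + y) z = cinner x z + cinner y z"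
    by transfer (simp add: distrib_right infsum_add ell2_summable_mult)
  show cs: "cinner (c *\<^sub>C x) y = c * cinner x y" for c
    by transfer (simp add: mult.assoc infsum_cmult_right ell2_summable_mult)
  show "inner x y = inner y x"
    unfolding inner_ell2_def by (subst cc) simp
  show "inner (x + y) z = inner x z + inner y z"
    unfolding inner_ell2_def by (simp add: ca)
  show "inner (r *\<^sub>R x) y = r * inner x y"
    unfolding inner_ell2_def scaleR_ell2_def by (simp add: cs)
  have ip: "inner x x = (\<Sum>\<^sub>\<infinity>i. (cmod (ell2_coord x i))\<^sup>2)"
    unfolding inner_ell2_def
  proof transfer
    fix f :: "'a \<Rightarrow> complex"
    assume f: "(\<lambda>i. (cmod (f i))\<^sup>2) summable_on UNIV"
    have "(\<Sum>\<^sub>\<infinity>i. f i * cnj (f i)) = (\<Sum>\<^sub>\<infinity>i. complex_of_real ((cmod (f i))\<^sup>2))"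
      by (simp only: complex_norm_square)
    also have "\<dots> = complex_of_real (\<Sum>\<^sub>\<infinity>i. (cmod (f i))\<^sup>2)"
      by (rule infsumI[OF has_sum_of_real[OF has_sum_infsum[OF f]]])
    finally show "Re (\<Sum>\<^sub>\<infinity>i. f i * cnj (f i)) = (\<Sum>\<^sub>\<infinity>i. (cmod (f i))\<^sup>2)" by simp
  qed
  show "0 \<le> inner x x" unfolding ip by (rule infsum_nonneg) simp
  show "inner x x = 0 \<longleftrightarrow> x = 0"
  proof
    assume 0: "inner x x = 0"
    have sx: "(\<lambda>i. (cmod (ell2_coord x i))\<^sup>2) summable_on UNIV"
      using ell2_coord[of x] by simp
    have "(cmod (ell2_coord x i))\<^sup>2 \<le> 0" for i
      using finite_sum_le_infsum[OF sx, of "{i}"] 0 ip by simp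
    then have "ell2_coord x i = 0" for i
      by simp
    then have "ell2_coord x = ell2_coord 0" by (auto simp: zero_ell2.rep_eq)
    then show "x = 0" by (simp add: ell2_coord_inject)
  next
    assume "x = 0"
    then show "inner x x = 0" unfolding ip by (simp add: zero_ell2.rep_eq)
  qed
  show "norm x = sqrt (inner x x)" by (rule norm_ell2_def)
  show "sgn x = inverse (norm x) *\<^sub>R x" by (rule sgn_ell2_def)
  show "dist x y = norm (x - y)" by (rule dist_ell2_def)
  show "(uniformity :: ('a ell2 \<times> 'a ell2) filter) =
      (INF e\<in>{0<..}. principal {(x, y). dist x y < e})"
    by (rule uniformity_ell2_def)
  show "open U \<longleftrightarrow> (\<forall>x\<in>U. eventually (\<lambda>(x', y). x' = x \<longrightarrow> y \<in> U) uniformity)"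
    for U :: "'a ell2 set"
    by (rule open_ell2_def)
qed

end

lemma ell2_summable_coord: "(\<lambda>i. (cmod (ell2_coord x i))\<^sup>2) summable_on UNIV"
  using ell2_coord[of x] by simp

lemma ell2_norm_square: "(norm x)\<^sup>2 = (\<Sum>\<^sub>\<infinity>i. (cmod (ell2_coord x i))\<^sup>2)"
proof -
  have "(\<Sum>\<^sub>\<infinity>i. ell2_coord x i * cnj (ell2_coord x i)) =
      (\<Sum>\<^sub>\<infinity>i. complex_of_real ((cmod (ell2_coord x i))\<^sup>2))"
    by (simp only: complex_norm_square)
  also have "\<dots> = complex_of_real (\<Sum>\<^sub>\<infinity>i. (cmod (ell2_coord x i))\<^sup>2)"
    by (rule infsumI[OF has_sum_of_real[OF has_sum_infsum[OF ell2_summable_coord]]])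
  finally show ?thesis
    by (simp add: power2_norm_eq_inner inner_eq_Re_cinner cinner_ell2.rep_eq)
qed

lemma ell2_finite_sum_le_norm:
  "finite F \<Longrightarrow> (\<Sum>i\<in>F. (cmod (ell2_coord x i))\<^sup>2) \<le> (norm x)\<^sup>2"
  unfolding ell2_norm_square by (rule finite_sum_le_infsum[OF ell2_summable_coord]) auto

instance ell2 :: (type) chilbert
proof
  fix X :: "nat \<Rightarrow> 'a ell2"
  assume X: "Cauchy X"
  have le: "cmod (ell2_coord x i) \<le> norm x" for x :: "'a ell2" and i
    using ell2_finite_sum_le_norm[of "{i}" x] by (simp add: power2_le_iff_abs_le)
  have "Cauchy (\<lambda>n. ell2_coord (X n) i)" for i
  proof (rule metric_CauchyI)
    fix e :: real assume "0 < e"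
    then obtain M where M: "\<forall>m\<ge>M. \<forall>n\<ge>M. dist (X m) (X n) < e"
      using X unfolding Cauchy_def by blast
    have "dist (ell2_coord (X m) i) (ell2_coord (X n) i) \<le> dist (X m) (X n)" for m n
      using le[of "X m - X n" i] by (simp add: dist_norm minus_ell2.rep_eq)
    then show "\<exists>M. \<forall>m\<ge>M. \<forall>n\<ge>M. dist (ell2_coord (X m) i) (ell2_coord (X n) i) < e"
      using M by (meson le_less_trans)
  qed
  then have "\<exists>l. (\<lambda>n. ell2_coord (X n) i) \<longlonglongrightarrow> l" for i
    using Cauchy_convergent convergent_def by blast
  then obtain f where f: "\<And>i. (\<lambda>n. ell2_coord (X n) i) \<longlonglongrightarrow> f i" by metis
  have tail: "(\<Sum>i\<in>F. (cmod (ell2_coord (X m) i - f i))\<^sup>2) \<le> e\<^sup>2"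
    if M: "\<forall>m\<ge>M. \<forall>n\<ge>M. dist (X m) (X n) < e" and m: "m \<ge> M" and F: "finite F"
    for M e m F
  proof (rule tendsto_upperbound)
    show "(\<lambda>n. \<Sum>i\<in>F. (cmod (ell2_coord (X m) i - ell2_coord (X n) i))\<^sup>2)
        \<longlonglongrightarrow> (\<Sum>i\<in>F. (cmod (ell2_coord (X m) i - f i))\<^sup>2)"
      by (intro tendsto_intros f)
    show "\<forall>\<^sub>F n in sequentially.
        (\<Sum>i\<in>F. (cmod (ell2_coord (X m) i - ell2_coord (X n) i))\<^sup>2) \<le> e\<^sup>2"
    proof (rule eventually_sequentiallyI[of M])
      fix n assume "M \<le> n"
      then have "norm (X m - X n) \<le> e" using M m by (auto simp: dist_norm less_imp_le)
      then have "(norm (X m - X n))\<^sup>2 \<le> e\<^sup>2" by (intro power_mono) auto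
      then show "(\<Sum>i\<in>F. (cmod (ell2_coord (X m) i - ell2_coord (X n) i))\<^sup>2) \<le> e\<^sup>2"
        using ell2_finite_sum_le_norm[OF F, of "X m - X n"] by (simp add: minus_ell2.rep_eq)
    qed
  qed simp
  have sd: "(\<lambda>i. (cmod (ell2_coord (X m) i - f i))\<^sup>2) summable_on UNIV"
    if "\<forall>m\<ge>M. \<forall>n\<ge>M. dist (X m) (X n) < e" "m \<ge> M" for M e m
    by (rule nonneg_bdd_above_summable_on)
      (auto intro!: bdd_aboveI2[where M = "e\<^sup>2"] tail[OF that])
  have sf: "(\<lambda>i. (cmod (f i))\<^sup>2) summable_on UNIV"
  proof -
    obtain M where "\<forall>m\<ge>M. \<forall>n\<ge>M. dist (X m) (X n) < 1"
      using X zero_less_one unfolding Cauchy_def by blast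
    from sd[OF this order_refl]
    have "(\<lambda>i. (cmod (- (ell2_coord (X M) i - f i)))\<^sup>2) summable_on UNIV"
      by (simp only: norm_minus_cancel)
    from ell2_summable_add[OF ell2_summable_coord[of "X M"] this] show ?thesis by simp
  qed
  define L where "L = Abs_ell2 f"
  have L: "ell2_coord L = f" unfolding L_def using sf by (simp add: Abs_ell2_inverse)
  have "X \<longlonglongrightarrow> L"
  proof (rule metric_LIMSEQ_I)
    fix r :: real assume r: "0 < r"
    then have "0 < r / 2" by simp
    then obtain M where M: "\<forall>m\<ge>M. \<forall>n\<ge>M. dist (X m) (X n) < r / 2"
      using X unfolding Cauchy_def by blast
    have "dist (X m) L < r" if "m \<ge> M" for m
    proof -
      have "(norm (X m - L))\<^sup>2 \<le> (r / 2)\<^sup>2"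
        unfolding ell2_norm_square minus_ell2.rep_eq L
        by (rule infsum_le_finite_sums[OF sd[OF M that]]) (rule tail[OF M that])
      then have "norm (X m - L) \<le> r / 2"
        by (rule power2_le_imp_le) (use r in simp)
      then show ?thesis using r by (simp add: dist_norm)
    qed
    then show "\<exists>M. \<forall>m\<ge>M. dist (X m) L < r" by blast
  qed
  then show "convergent X" by (auto simp: convergent_def)
qed

section \<open>Operators between Hilbert spaces\<close>

instantiation blinfun :: (real_normed_vector, complex_inner) complex_vector
begin

lift_definition scaleC_blinfun :: "complex \<Rightarrow> ('a \<Rightarrow>\<^sub>L 'b) \<Rightarrow> ('a \<Rightarrow>\<^sub>L 'b)"
  is "\<lambda>c T x. c *\<^sub>C T x"
  by (rule bounded_linear_compose[OF bounded_linear_scaleC])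

instance
  by standard
    (transfer; simp add: fun_eq_iff scaleC_add_right scaleC_add_left scaleC_scaleC scaleC_one)+

end

text \<open>\<open>'k \<Rightarrow>\<^sub>L 'h\<close> consists of the bounded real-linear maps; \<open>B(K,H)\<close> is the set of the
  complex-linear ones among them, with the operator norm and norm topology of \<open>'k \<Rightarrow>\<^sub>L 'h\<close>.\<close>

definition bounded_ops :: "('k::chilbert \<Rightarrow>\<^sub>L 'h::chilbert) set" where
  "bounded_ops = {T. \<forall>c x. blinfun_apply T (c *\<^sub>C x) = c *\<^sub>C blinfun_apply T x}"

text \<open>The Hilbert space adjoint; by the Riesz theorem it exists for \<open>T\<close> in \<open>B(K,H)\<close>.\<close>

definition adj :: "('k::chilbert \<Rightarrow>\<^sub>L 'h::chilbert) \<Rightarrow> ('h \<Rightarrow>\<^sub>L 'k)" where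
  "adj T = (THE S. \<forall>x y. cinner (blinfun_apply T x) y = cinner x (blinfun_apply S y))"

text \<open>Norm of the \<open>n \<times> n\<close> operator matrix \<open>[x p q]\<close> as an operator from \<open>K\<^sup>n\<close> to \<open>H\<^sup>n\<close>.
  Matrices over any set are functions of two indices, of which only the entries with both
  indices below \<open>n\<close> matter.\<close>

definition op_mnorm :: "nat \<Rightarrow> (nat \<Rightarrow> nat \<Rightarrow> ('k::chilbert \<Rightarrow>\<^sub>L 'h::chilbert)) \<Rightarrow> real" where
  "op_mnorm n x =
     (SUP \<xi> \<in> {\<xi> :: nat \<Rightarrow> 'k. L2_set (\<lambda>q. norm (\<xi> q)) {..<n} \<le> 1}.
        L2_set (\<lambda>p. norm (\<Sum>q<n. blinfun_apply (x p q) (\<xi> q))) {..<n})"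

definition op_prod :: "('k::chilbert \<Rightarrow>\<^sub>L 'h::chilbert) set \<Rightarrow> ('l::chilbert \<Rightarrow>\<^sub>L 'k) set \<Rightarrow> ('l \<Rightarrow>\<^sub>L 'h) set" where
  "op_prod X Y = closure {\<Sum>m<n. x m o\<^sub>L y m | (n::nat) x y. \<forall>m<n. x m \<in> X \<and> y m \<in> Y}"

section \<open>Operator algebras and complete isometries\<close>

definition complete_isometry ::
  "'a set \<Rightarrow> (nat \<Rightarrow> (nat \<Rightarrow> nat \<Rightarrow> 'a) \<Rightarrow> real) \<Rightarrow> (nat \<Rightarrow> (nat \<Rightarrow> nat \<Rightarrow> 'b) \<Rightarrow> real) \<Rightarrow> ('a \<Rightarrow> 'b) \<Rightarrow> bool"
  where
  "complete_isometry X N M f \<longleftrightarrow>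
     (\<forall>n\<ge>1. \<forall>x. (\<forall>p<n. \<forall>q<n. x p q \<in> X) \<longrightarrow> M n (\<lambda>p q. f (x p q)) = N n x)"

text \<open>\<open>N\<close> is the family of matrix norms of the algebra, \<open>N n\<close> being the norm of
  \<open>M\<^sub>n(A)\<close>; the norm of \<open>a\<close> itself is that of the \<open>1 \<times> 1\<close> matrix \<open>\<lambda>_ _. a\<close>.
  The algebra is the whole type \<open>'a\<close>, and it is represented on the Hilbert space \<open>'g\<close>.\<close>

definition operator_algebra ::
  "'g::chilbert itself \<Rightarrow> (nat \<Rightarrow> (nat \<Rightarrow> nat \<Rightarrow> 'a::complex_algebra) \<Rightarrow> real) \<Rightarrow> bool" where
  "operator_algebra _ N \<longleftrightarrow>
     (\<exists>\<rho> :: 'a \<Rightarrow> ('g \<Rightarrow>\<^sub>L 'g).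
        range \<rho> \<subseteq> bounded_ops \<and> clinear_on UNIV \<rho> \<and>
        (\<forall>a b. \<rho> (a * b) = \<rho> a o\<^sub>L \<rho> b) \<and>
        complete_isometry UNIV N op_mnorm \<rho>) \<and>
     Metric_space.mcomplete UNIV (\<lambda>a b. N 1 (\<lambda>_ _. a - b))"

text \<open>A net is given by a family \<open>e\<close> together with a proper filter \<open>F\<close> on its index type
  (for a directed index set: the filter generated by the tails). The product and the norm
  are parameters, in order to cover both abstract algebras and sets of operators.\<close>

definition right_cai ::
  "('a::minus \<Rightarrow> 'a \<Rightarrow> 'a) \<Rightarrow> ('a \<Rightarrow> real) \<Rightarrow> 'a set \<Rightarrow> ('d \<Rightarrow> 'a) \<Rightarrow> 'd filter \<Rightarrow> bool" where
  "right_cai m nrm A e F \<longleftrightarrow>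
     F \<noteq> bot \<and> (\<forall>\<alpha>. e \<alpha> \<in> A \<and> nrm (e \<alpha>) \<le> 1) \<and>
     (\<forall>a\<in>A. ((\<lambda>\<alpha>. nrm (m a (e \<alpha>) - a)) \<longlongrightarrow> 0) F)"

definition left_ideal :: "('h::chilbert \<Rightarrow>\<^sub>L 'h) set \<Rightarrow> ('h \<Rightarrow>\<^sub>L 'h) set \<Rightarrow> bool" where
  "left_ideal C J \<longleftrightarrow>
     J \<subseteq> C \<and> csubspace J \<and> closed J \<and> (\<forall>c\<in>C. \<forall>x\<in>J. c o\<^sub>L x \<in> J)"

section \<open>Triple systems and triple envelopes\<close>

text \<open>\<open>C\<^sup>*\<close>-algebras are taken concretely, as norm closed \<open>*\<close>-subalgebras of some \<open>B(H)\<close>.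
  With off-diagonal corners allowed, a triple system is thus a norm closed subspace \<open>X\<close> of
  some \<open>B(K,H)\<close> with \<open>X X\<^sup>* X \<subseteq> X\<close>.\<close>

definition triple_system :: "('k::chilbert \<Rightarrow>\<^sub>L 'h::chilbert) set \<Rightarrow> bool" where
  "triple_system X \<longleftrightarrow>
     X \<subseteq> bounded_ops \<and> csubspace X \<and> closed X \<and>
     (\<forall>x\<in>X. \<forall>y\<in>X. \<forall>z\<in>X. x o\<^sub>L adj y o\<^sub>L z \<in> X)"

definition triple_subspace ::
  "('k::chilbert \<Rightarrow>\<^sub>L 'h::chilbert) set \<Rightarrow> ('k \<Rightarrow>\<^sub>L 'h) set \<Rightarrow> bool" where
  "triple_subspace X W \<longleftrightarrow> W \<subseteq> X \<and> triple_system W"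

definition triple_morphism ::
  "('k::chilbert \<Rightarrow>\<^sub>L 'h::chilbert) set \<Rightarrow> ('p::chilbert \<Rightarrow>\<^sub>L 'q::chilbert) set \<Rightarrow>
   (('k \<Rightarrow>\<^sub>L 'h) \<Rightarrow> ('p \<Rightarrow>\<^sub>L 'q)) \<Rightarrow> bool" where
  "triple_morphism X Y T \<longleftrightarrow>
     T ` X \<subseteq> Y \<and> clinear_on X T \<and>
     (\<forall>x\<in>X. \<forall>y\<in>X. \<forall>z\<in>X. T (x o\<^sub>L adj y o\<^sub>L z) = T x o\<^sub>L adj (T y) o\<^sub>L T z)"

definition left_cstar :: "('k::chilbert \<Rightarrow>\<^sub>L 'h::chilbert) set \<Rightarrow> ('h \<Rightarrow>\<^sub>L 'h) set" where
  "left_cstar X = op_prod X (adj ` X)"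

text \<open>A triple extension: \<open>i\<close> is a linear complete isometry into \<open>T\<close>, and no proper triple
  subspace of \<open>T\<close> contains its range.\<close>

definition triple_extension ::
  "(nat \<Rightarrow> (nat \<Rightarrow> nat \<Rightarrow> 'a::complex_vector) \<Rightarrow> real) \<Rightarrow>
   ('k::chilbert \<Rightarrow>\<^sub>L 'h::chilbert) set \<Rightarrow> ('a \<Rightarrow> ('k \<Rightarrow>\<^sub>L 'h)) \<Rightarrow> bool" where
  "triple_extension N T i \<longleftrightarrow>
     triple_system T \<and> range i \<subseteq> T \<and> clinear_on UNIV i \<and>
     complete_isometry UNIV N op_mnorm i \<and>
     (\<forall>W. triple_subspace T W \<and> range i \<subseteq> W \<longrightarrow> W = T)"

text \<open>A formula cannot quantify over all Hilbert spaces (types), so the universal property is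
  parametrized by Hilbert spaces \<open>'p\<close> and \<open>'q\<close>: it is tested against the
  triple systems \<open>Z\<close> in \<open>B('p,'q)\<close>.\<close>

definition triple_envelope_wrt ::
  "'p::chilbert itself \<Rightarrow> 'q::chilbert itself \<Rightarrow>
   (nat \<Rightarrow> (nat \<Rightarrow> nat \<Rightarrow> 'a::complex_vector) \<Rightarrow> real) \<Rightarrow>
   ('k::chilbert \<Rightarrow>\<^sub>L 'h::chilbert) set \<Rightarrow> ('a \<Rightarrow> ('k \<Rightarrow>\<^sub>L 'h)) \<Rightarrow> bool" where
  "triple_envelope_wrt _ _ N T i \<longleftrightarrow>
     triple_extension N T i \<and>
     (\<forall>(Z :: ('p \<Rightarrow>\<^sub>L 'q) set) k. triple_extension N Z k \<longrightarrow>
        (\<exists>\<theta>. triple_morphism Z T \<theta> \<and> (\<forall>a. \<theta> (k a) = i a)))"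

text \<open>It suffices to test against triple systems on the Hilbert space with orthonormal basis
  indexed by the operator space \<open>'a\<close> itself: if \<open>k\<close> is a complete isometry of \<open>'a\<close> (nonzero,
  hence infinite) into \<open>Z \<subseteq> B('p,'q)\<close>, there are closed subspaces of \<open>'p\<close> and \<open>'q\<close> of
  dimension at most the cardinality of \<open>'a\<close>, invariant under the triple system generated by
  the range of \<open>k\<close>, to which \<open>k\<close> can be compressed without changing the matrix norms.\<close>

abbreviation triple_envelope ::
  "(nat \<Rightarrow> (nat \<Rightarrow> nat \<Rightarrow> 'a::complex_vector) \<Rightarrow> real) \<Rightarrow>
   ('k::chilbert \<Rightarrow>\<^sub>L 'h::chilbert) set \<Rightarrow> ('a \<Rightarrow> ('k \<Rightarrow>\<^sub>L 'h)) \<Rightarrow> bool" where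
  "triple_envelope \<equiv> triple_envelope_wrt TYPE('a ell2) TYPE('a ell2)"

end

theory Submission
  imports Defs "HOL-Library.Equipollence"
begin

text \<open>
  Represent \<open>A\<close> completely isometrically on a Hilbert space by \<open>\<rho>\<close> and let \<open>Z\<close> be the triple system
  generated by \<open>\<rho>(A)\<close>. The universal property gives a triple morphism \<open>\<theta>\<close> from \<open>Z\<close> to the envelope
  \<open>T\<close> with \<open>\<theta> \<circ> \<rho> = i\<close>. The algebra structure of \<open>A\<close> is visible in \<open>Z\<close>: writing \<open>f\<close> for
  \<open>\<rho>(e\<^sub>\<alpha>)\<close>, contractivity of \<open>f\<close> and \<open>a f \<rightarrow> a\<close> force \<open>a f\<^sup>* \<rightarrow> a\<close> as well
  (\<open>norm_compose_adj_contraction_le\<close>), hence \<open>a f\<^sup>* f \<rightarrow> a\<close>, for every \<open>a\<close> in \<open>\<rho>(A)\<close>.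

  These facts are transported to \<open>T\<close> by the estimate \<open>\<parallel>\<theta>(z) \<theta>(g)\<^sup>*\<parallel> \<le> \<parallel>z g\<^sup>*\<parallel>\<close>
  (\<open>triple_morphism_norm_compose_adj\<close>), which expresses that the \<open>*\<close>-homomorphism of left
  \<open>C\<^sup>*\<close>-algebras induced by \<open>\<theta>\<close> is contractive. It shows that \<open>x i(e\<^sub>\<alpha>)\<^sup>*\<close> converges to some \<open>\<psi>(x)\<close>
  and that \<open>x i(e\<^sub>\<alpha>)\<^sup>* i(e\<^sub>\<alpha>) \<rightarrow> x\<close>, for \<open>x\<close> in \<open>i(A)\<close>; the set of all \<open>x\<close> in \<open>T\<close> with these
  properties is a triple subspace, so it is \<open>T\<close>.

  The rest is algebra. Multiplying \<open>x i(e\<^sub>\<alpha>)\<^sup>*\<close> with the adjoint of \<open>y i(e\<^sub>\<alpha>)\<^sup>*\<close> gives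
  \<open>\<psi>(x) \<psi>(y)\<^sup>* = x y\<^sup>*\<close> in the limit. The norm of an operator matrix depends only on the products
  \<open>x y\<^sup>*\<close> of its entries (\<open>op_mnorm_le_of_gram\<close>), so \<open>\<psi>\<close> is a complete isometry. Together
  with \<open>\<psi>(x y\<^sup>* z) = x y\<^sup>* \<psi>(z)\<close>, which is clear from the definition, it also makes \<open>\<psi>\<close> a triple
  morphism whose range is a left ideal. Finally \<open>i(a) i(e\<^sub>\<alpha>)\<^sup>* i(b) = \<theta>(\<rho>(a) \<rho>(e\<^sub>\<alpha>)\<^sup>* \<rho>(b))\<close> gives
  \<open>\<psi>(i(a)) i(b) = i(a b)\<close>, which makes \<open>\<psi> \<circ> i\<close> multiplicative.

  A separate matter is that the universal property is given only for triple systems on \<open>\<ell>\<^sup>2\<close> of the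
  carrier of \<open>A\<close>. A triple extension on arbitrary Hilbert spaces is compressed to invariant subspaces that
  are spanned by families indexed by \<open>A\<close> and still carry all matrix norms
  (\<open>triple_extension_compress\<close>); such subspaces embed into \<open>\<ell>\<^sup>2\<close> (\<open>ell2_partial_isometry\<close>).
\<close>

section \<open>Complex subspaces and orthogonal projections\<close>

text \<open>The operators into a Hilbert space then form a Banach space.\<close>

instance chilbert \<subseteq> banach ..

lemma csubspace_iff:
  "csubspace S \<longleftrightarrow>
     0 \<in> S \<and> (\<forall>x\<in>S. \<forall>y\<in>S. x + y \<in> S) \<and> (\<forall>c. \<forall>x\<in>S. c *\<^sub>C x \<in> S)"
proof -
  have "module (scaleC :: complex \<Rightarrow> 'a \<Rightarrow> 'a)"
    by unfold_locales (auto simp: scaleC_add_right scaleC_add_left scaleC_scaleC scaleC_one)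
  then show ?thesis by (simp add: module.subspace_def)
qed

lemma scaleC_zero [simp]: "c *\<^sub>C (0::'a::complex_vector) = 0"
  using scaleC_add_right[of c 0 "0::'a"] by simp

lemma scaleC_zero_left [simp]: "0 *\<^sub>C (x::'a::complex_vector) = 0"
  using scaleC_add_left[of 0 0 x] by simp

lemma scaleC_minus_one: "(- 1) *\<^sub>C (x::'a::complex_vector) = - x"
  using scaleC_add_left[of 1 "-1" x] by (simp add: scaleC_one eq_neg_iff_add_eq_0 add.commute)

lemma csubspaceD:
  assumes "csubspace S"
  shows csubspace_0: "0 \<in> S"
    and csubspace_add: "x \<in> S \<Longrightarrow> y \<in> S \<Longrightarrow> x + y \<in> S"
    and csubspace_scaleC: "x \<in> S \<Longrightarrow> c *\<^sub>C x \<in> S"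
    and csubspace_diff: "x \<in> S \<Longrightarrow> y \<in> S \<Longrightarrow> x - y \<in> S"
proof -
  have add: "x + y \<in> S" if "x \<in> S" "y \<in> S" for x y
    using assms that by (auto simp: csubspace_iff)
  have sc: "c *\<^sub>C x \<in> S" if "x \<in> S" for x c
    using assms that by (auto simp: csubspace_iff)
  show "0 \<in> S" using assms by (auto simp: csubspace_iff)
  show "x \<in> S \<Longrightarrow> y \<in> S \<Longrightarrow> x + y \<in> S" by (rule add)
  show "x \<in> S \<Longrightarrow> c *\<^sub>C x \<in> S" by (rule sc)
  show "x \<in> S \<Longrightarrow> y \<in> S \<Longrightarrow> x - y \<in> S"
    using add[OF _ sc[of y "-1"], of x] by (simp add: scaleC_minus_one)
qed

lemma csubspace_sum:
  assumes "csubspace S" and "\<And>m. m < n \<Longrightarrow> f m \<in> S"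
  shows "(\<Sum>m<(n::nat). f m) \<in> S"
  using assms(2)
  by (induction n) (auto intro: csubspace_0[OF assms(1)] csubspace_add[OF assms(1)])

lemma csubspace_imp_subspace:
  fixes S :: "'a::complex_inner set"
  assumes "csubspace S" shows "subspace S"
  using assms by (auto simp: csubspace_iff subspace_def scaleR_scaleC)

text \<open>By the parallelogram law every minimising sequence for the distance from \<open>x\<close> to \<open>M\<close> is
  Cauchy, and its limit is a closest point.\<close>

lemma orthogonal_projection_exists:
  fixes M :: "'a::{real_inner,complete_space} set"
  assumes M: "subspace M" "closed M"
  shows "\<exists>m\<in>M. \<forall>y\<in>M. inner (x - m) y = 0"
proof -
  define D where "D = (INF y\<in>M. (norm (x - y))\<^sup>2)"
  have ne: "M \<noteq> {}" using subspace_0[OF M(1)] by blast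
  have bdd: "bdd_below ((\<lambda>y. (norm (x - y))\<^sup>2) ` M)"
    by (rule bdd_belowI2[where m = 0]) simp
  have D_le: "D \<le> (norm (x - y))\<^sup>2" if "y \<in> M" for y
    unfolding D_def by (rule cINF_lower[OF bdd that])
  have "\<exists>y\<in>M. (norm (x - y))\<^sup>2 < D + inverse (real (Suc n))" for n
  proof -
    have "D < D + inverse (real (Suc n))" by simp
    then show ?thesis
      unfolding D_def using cINF_less_iff[OF ne bdd] by blast
  qed
  then obtain m where mM: "\<And>n. m n \<in> M"
    and m: "\<And>n. (norm (x - m n))\<^sup>2 < D + inverse (real (Suc n))"
    by metis
  have par: "(norm (m k - m l))\<^sup>2 \<le> 2 * inverse (real (Suc k)) + 2 * inverse (real (Suc l))" for k l
  proof -
    let ?c = "(1/2) *\<^sub>R (m k + m l)"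
    have "?c \<in> M" by (intro subspace_scale subspace_add M mM)
    then have "D \<le> (norm (x - ?c))\<^sup>2" by (rule D_le)
    moreover have "(norm (m k - m l))\<^sup>2
        = 2 * (norm (x - m k))\<^sup>2 + 2 * (norm (x - m l))\<^sup>2 - 4 * (norm (x - ?c))\<^sup>2"
      by (simp add: power2_norm_eq_inner inner_diff_left inner_diff_right
          inner_add_left inner_add_right inner_commute field_simps)
    ultimately show ?thesis using m[of k] m[of l] by linarith
  qed
  have "Cauchy m"
  proof (rule metric_CauchyI)
    fix e :: real assume e: "0 < e"
    then have "0 < e\<^sup>2 / 4" by simp
    then obtain M0 where M0: "inverse (real (Suc M0)) < e\<^sup>2 / 4"
      using reals_Archimedean by blast
    have "dist (m k) (m l) < e" if "k \<ge> M0" "l \<ge> M0" for k l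
    proof -
      have "inverse (real (Suc k)) \<le> inverse (real (Suc M0))"
        "inverse (real (Suc l)) \<le> inverse (real (Suc M0))"
        using that by (auto intro!: le_imp_inverse_le)
      then have "(norm (m k - m l))\<^sup>2 < e\<^sup>2" using par[of k l] M0 by linarith
      then show ?thesis using e by (simp add: dist_norm power_less_imp_less_base)
    qed
    then show "\<exists>M. \<forall>k\<ge>M. \<forall>l\<ge>M. dist (m k) (m l) < e" by blast
  qed
  then obtain p where p: "m \<longlonglongrightarrow> p" using Cauchy_convergent convergent_def by blast
  have pM: "p \<in> M" using closed_sequentially[OF M(2) mM p] .
  have "(norm (x - p))\<^sup>2 \<le> D"
  proof (rule LIMSEQ_le)
    show "(\<lambda>n. (norm (x - m n))\<^sup>2) \<longlonglongrightarrow> (norm (x - p))\<^sup>2" by (intro tendsto_intros p)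
    show "(\<lambda>n. D + inverse (real (Suc n))) \<longlonglongrightarrow> D"
      using tendsto_add[OF tendsto_const LIMSEQ_inverse_real_of_nat, of D] by simp
  qed (use m in \<open>auto intro: less_imp_le\<close>)
  then have closest: "\<forall>z\<in>M. dist x p \<le> dist x z"
    using D_le by (metis (no_types) dist_norm norm_ge_zero order_trans power2_le_imp_le)
  have "inner (x - p) y = 0" if "y \<in> M" for y
  proof -
    have "p + y \<in> M" "p - y \<in> M" using pM that M(1) by (auto intro: subspace_add subspace_diff)
    then have "inner (x - p) y \<le> 0" "inner (x - p) (- y) \<le> 0"
      using any_closest_point_dot[OF subspace_imp_convex[OF M(1)] M(2) pM _ closest, of "p + y"]
        any_closest_point_dot[OF subspace_imp_convex[OF M(1)] M(2) pM _ closest, of "p - y"]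
      by auto
    then show ?thesis by simp
  qed
  then show ?thesis using pM by blast
qed

lemma riesz_representation:
  fixes f :: "'a::{real_inner,complete_space} \<Rightarrow> real"
  assumes f: "bounded_linear f"
  shows "\<exists>y. \<forall>x. f x = inner x y"
proof (cases "\<forall>x. f x = 0")
  case True
  then show ?thesis by (intro exI[of _ 0]) simp
next
  case False
  then obtain x where x: "f x \<noteq> 0" by blast
  interpret bounded_linear f by (rule f)
  have "subspace {v. f v = 0}" by (auto simp: subspace_def add scaleR zero)
  moreover have "closed {v. f v = 0}"
    by (intro closed_Collect_eq continuous_on continuous_intros)
  ultimately obtain m where m: "f m = 0" "\<And>y. f y = 0 \<Longrightarrow> inner (x - m) y = 0"
    using orthogonal_projection_exists by fastforce
  let ?u = "x - m"
  have fu: "f ?u = f x" by (simp add: diff m)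
  have u0: "inner ?u ?u \<noteq> 0" using fu x zero by auto
  have "f v = inner v ((f x / inner ?u ?u) *\<^sub>R ?u)" for v
  proof -
    have "f (v - (f v / f x) *\<^sub>R ?u) = 0" using x fu by (simp add: diff scaleR)
    then have "inner ?u (v - (f v / f x) *\<^sub>R ?u) = 0" by (rule m(2))
    then have "inner ?u v = (f v / f x) * inner ?u ?u" by (simp add: inner_diff_right)
    then show ?thesis using u0 x by (simp add: inner_commute[of v])
  qed
  then show ?thesis by blast
qed

section \<open>Adjoints\<close>

text \<open>For complex-linear operators the adjoint with respect to the real inner product is also the
  adjoint with respect to the complex one, because the real part of \<open>cinner\<close> determines its
  imaginary part. Most arguments below can therefore stay with the real inner product.\<close>

lemma inner_imaginary: "inner (\<i> *\<^sub>C x) y = - inner x (\<i> *\<^sub>C (y::'a::complex_inner))"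
proof -
  have "cinner x (\<i> *\<^sub>C y) = cnj \<i> * cinner x y"
    by (metis cinner_commute cinner_scaleC_left complex_cnj_mult)
  then show ?thesis by (simp add: inner_eq_Re_cinner cinner_scaleC_left)
qed

lemma cinner_eq_Complex_inner:
  "cinner x y = Complex (inner x y) (inner x (\<i> *\<^sub>C (y::'a::complex_inner)))"
proof -
  have "inner x (\<i> *\<^sub>C y) = Im (cinner x y)"
    using inner_imaginary[of x y] by (simp add: inner_eq_Re_cinner[of "\<i> *\<^sub>C x"] cinner_scaleC_left)
  then show ?thesis by (simp add: complex_eq_iff inner_eq_Re_cinner)
qed

lemma bounded_opsD: "T \<in> bounded_ops \<Longrightarrow> T (c *\<^sub>C x) = c *\<^sub>C T x"
  by (simp add: bounded_ops_def)

lemma adj_unique: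
  fixes T :: "'k::chilbert \<Rightarrow>\<^sub>L 'h::chilbert" and S :: "'h \<Rightarrow>\<^sub>L 'k"
  assumes T: "T \<in> bounded_ops" and S: "\<And>x y. inner (T x) y = inner x (S y)"
  shows "adj T = S"
  unfolding adj_def
proof (rule the_equality)
  show "\<forall>x y. cinner (T x) y = cinner x (S y)"
  proof (intro allI)
    fix x y
    have "inner (T x) (\<i> *\<^sub>C y) = inner x (\<i> *\<^sub>C S y)"
      using S[of "\<i> *\<^sub>C x" y] by (simp add: bounded_opsD[OF T] inner_imaginary)
    then show "cinner (T x) y = cinner x (S y)" by (simp add: cinner_eq_Complex_inner S)
  qed
next
  fix R :: "'h \<Rightarrow>\<^sub>L 'k"
  assume R: "\<forall>x y. cinner (T x) y = cinner x (R y)"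
  have "inner x (R y - S y) = 0" for x y
    using R by (simp add: inner_diff_right S[symmetric]) (simp add: inner_eq_Re_cinner)
  then have "R y - S y = 0" for y by (metis inner_eq_zero_iff)
  then show "R = S" by (intro blinfun_eqI) simp
qed

lemma adj_inner:
  fixes T :: "'k::chilbert \<Rightarrow>\<^sub>L 'h::chilbert"
  assumes T: "T \<in> bounded_ops"
  shows "inner (T x) y = inner x (adj T y)"
proof -
  have "\<exists>z. \<forall>x. inner (T x) y = inner x z" for y
    by (rule riesz_representation)
      (rule bounded_linear_compose[OF bounded_linear_inner_left blinfun.bounded_linear_right])
  then obtain S where S: "\<And>x y. inner (T x) y = inner x (S y)" by metis
  have eq: "u = v" if "\<And>x. inner x u = inner x v" for u v :: 'k
    using that[of "u - v"] by (metis inner_diff_right inner_eq_zero_iff eq_iff_diff_eq_0)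
  have "bounded_linear S"
  proof (rule bounded_linear_intro[where K = "norm T"])
    show "S (y + z) = S y + S z" for y z
      by (rule eq) (simp add: S[symmetric] inner_add_right)
    show "S (r *\<^sub>R y) = r *\<^sub>R S y" for r y
      by (rule eq) (simp add: S[symmetric])
    show "norm (S y) \<le> norm y * norm T" for y
    proof (cases "S y = 0")
      case False
      have "norm (S y) * norm (S y) = inner (T (S y)) y"
        by (simp add: S power2_norm_eq_inner[symmetric] power2_eq_square)
      also have "\<dots> \<le> norm (T (S y)) * norm y" by (rule norm_cauchy_schwarz)
      also have "\<dots> \<le> norm (S y) * (norm y * norm T)"
        using mult_right_mono[OF norm_blinfun[of T "S y"], of "norm y"] by (simp add: mult_ac)
      finally show ?thesis using False by simp
    qed simp
  qed
  then have B: "blinfun_apply (Blinfun S) = S" by (rule bounded_linear_Blinfun_apply)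
  have "adj T = Blinfun S" by (rule adj_unique[OF T]) (simp add: B S)
  then show ?thesis by (simp add: B S)
qed

lemma adj_bounded_ops [simp]:
  fixes T :: "'k::chilbert \<Rightarrow>\<^sub>L 'h::chilbert"
  assumes T: "T \<in> bounded_ops"
  shows "adj T \<in> bounded_ops"
proof -
  have eq: "u = v" if "\<And>x. cinner x u = cinner x v" for u v :: 'k
    using that[of "u - v"]
    by (metis inner_diff_right inner_eq_zero_iff eq_iff_diff_eq_0 inner_eq_Re_cinner)
  have ci: "cinner (T x) y = cinner x (adj T y)" for x y
  proof -
    have "inner (T x) (\<i> *\<^sub>C y) = inner x (\<i> *\<^sub>C adj T y)"
      using adj_inner[OF T, of "\<i> *\<^sub>C x" y] by (simp add: bounded_opsD[OF T] inner_imaginary)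
    then show ?thesis by (simp add: cinner_eq_Complex_inner adj_inner[OF T])
  qed
  have r: "cinner u (c *\<^sub>C v) = cnj c * cinner u v" for c and u v :: "'z::complex_inner"
    by (metis cinner_commute cinner_scaleC_left complex_cnj_mult)
  have "adj T (c *\<^sub>C y) = c *\<^sub>C adj T y" for c y
    by (rule eq) (simp add: ci[symmetric] r)
  then show ?thesis by (simp add: bounded_ops_def)
qed

lemma adj_adj [simp]: "T \<in> bounded_ops \<Longrightarrow> adj (adj T) = T"
  by (rule adj_unique) (simp, metis adj_inner inner_commute)

lemma bounded_ops_compose [simp]:
  "S \<in> bounded_ops \<Longrightarrow> T \<in> bounded_ops \<Longrightarrow> S o\<^sub>L T \<in> bounded_ops"
  by (simp add: bounded_ops_def)

lemma adj_compose:
  "S \<in> bounded_ops \<Longrightarrow> T \<in> bounded_ops \<Longrightarrow> adj (S o\<^sub>L T) = adj T o\<^sub>L adj S"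
  by (rule adj_unique) (auto simp: adj_inner)

lemma csubspace_bounded_ops: "csubspace bounded_ops"
  by (simp add: csubspace_iff bounded_ops_def blinfun.add_left scaleC_blinfun.rep_eq
      scaleC_add_right scaleC_scaleC mult.commute)

lemmas bounded_ops_add [simp] = csubspace_add[OF csubspace_bounded_ops]
  and bounded_ops_diff [simp] = csubspace_diff[OF csubspace_bounded_ops]
  and bounded_ops_scaleC [simp] = csubspace_scaleC[OF csubspace_bounded_ops]
  and bounded_ops_zero [simp] = csubspace_0[OF csubspace_bounded_ops]

lemma adj_add: "S \<in> bounded_ops \<Longrightarrow> T \<in> bounded_ops \<Longrightarrow> adj (S + T) = adj S + adj T"
  by (rule adj_unique)
    (auto simp: adj_inner blinfun.add_left inner_add_left inner_add_right)

lemma adj_diff: "S \<in> bounded_ops \<Longrightarrow> T \<in> bounded_ops \<Longrightarrow> adj (S - T) = adj S - adj T"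
  by (rule adj_unique)
    (auto simp: adj_inner blinfun.diff_left inner_diff_left inner_diff_right)

lemma inner_scaleC_left: "inner (c *\<^sub>C x) y = inner x (cnj c *\<^sub>C (y::'a::complex_inner))"
  by (metis (no_types, lifting) cinner_commute cinner_scaleC_left complex_cnj_cnj
      complex_cnj_mult inner_eq_Re_cinner)

lemma adj_scaleC:
  fixes T :: "'k::chilbert \<Rightarrow>\<^sub>L 'h::chilbert"
  assumes "T \<in> bounded_ops" shows "adj (c *\<^sub>C T) = cnj c *\<^sub>C adj T"
proof (rule adj_unique)
  show "inner ((c *\<^sub>C T) x) y = inner x ((cnj c *\<^sub>C adj T) y)" for x y
    using assms inner_scaleC_left[of c "T x" y]
    by (simp add: scaleC_blinfun.rep_eq adj_inner bounded_opsD[OF adj_bounded_ops])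
qed (use assms in simp)

lemma norm_square_le_norm_adj_compose:
  fixes S :: "'k::chilbert \<Rightarrow>\<^sub>L 'h::chilbert"
  assumes S: "S \<in> bounded_ops"
  shows "(norm S)\<^sup>2 \<le> norm (adj S o\<^sub>L S)"
proof -
  have "norm S \<le> sqrt (norm (adj S o\<^sub>L S))"
  proof (rule norm_blinfun_bound)
    fix x
    have "(norm (S x))\<^sup>2 = inner x ((adj S o\<^sub>L S) x)"
      by (simp add: power2_norm_eq_inner adj_inner[OF S])
    also have "\<dots> \<le> norm x * norm ((adj S o\<^sub>L S) x)" by (rule norm_cauchy_schwarz)
    also have "\<dots> \<le> norm x * (norm (adj S o\<^sub>L S) * norm x)"
      by (intro mult_left_mono norm_blinfun) simp
    finally have "(norm (S x))\<^sup>2 \<le> (sqrt (norm (adj S o\<^sub>L S)) * norm x)\<^sup>2"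
      by (simp add: power_mult_distrib power2_eq_square mult_ac)
    then show "norm (S x) \<le> sqrt (norm (adj S o\<^sub>L S)) * norm x"
      by (rule power2_le_imp_le) simp
  qed simp
  then have "(norm S)\<^sup>2 \<le> (sqrt (norm (adj S o\<^sub>L S)))\<^sup>2" by (intro power_mono) auto
  then show ?thesis by simp
qed

lemma norm_adj [simp]:
  assumes T: "T \<in> bounded_ops" shows "norm (adj T) = norm T"
proof -
  have le: "norm S \<le> norm (adj S)" if "S \<in> bounded_ops" for S :: "'u::chilbert \<Rightarrow>\<^sub>L 'v::chilbert"
  proof (cases "S = 0")
    case False
    have "norm S * norm S \<le> norm (adj S) * norm S"
      using order_trans[OF norm_square_le_norm_adj_compose[OF that] norm_blinfun_compose]
      by (simp add: power2_eq_square)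
    then show ?thesis using False by simp
  qed simp
  show ?thesis using le[OF T] le[OF adj_bounded_ops[OF T]] T by simp
qed

lemma norm_compose_adj:
  fixes T :: "'k::chilbert \<Rightarrow>\<^sub>L 'h::chilbert"
  assumes T: "T \<in> bounded_ops"
  shows "norm (T o\<^sub>L adj T) = (norm T)\<^sup>2"
proof (rule antisym)
  show "norm (T o\<^sub>L adj T) \<le> (norm T)\<^sup>2"
    using norm_blinfun_compose[of T "adj T"] T by (simp add: power2_eq_square)
  show "(norm T)\<^sup>2 \<le> norm (T o\<^sub>L adj T)"
    using norm_square_le_norm_adj_compose[OF adj_bounded_ops[OF T]] T by simp
qed

lemma norm_scaleC_blinfun_le: "norm (c *\<^sub>C T) \<le> cmod c * norm (T :: 'k::chilbert \<Rightarrow>\<^sub>L 'h::chilbert)"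
  by (rule norm_blinfun_bound)
    (auto simp: scaleC_blinfun.rep_eq norm_scaleC mult.assoc norm_blinfun mult_left_mono)

lemma bounded_linear_scaleC_blinfun:
  "bounded_linear (\<lambda>T :: 'k::chilbert \<Rightarrow>\<^sub>L 'h::chilbert. c *\<^sub>C T)"
proof (rule bounded_linear_intro[where K = "cmod c"])
  show "c *\<^sub>C (x + y) = c *\<^sub>C x + c *\<^sub>C y" for x y :: "'k \<Rightarrow>\<^sub>L 'h" by (rule scaleC_add_right)
  show "c *\<^sub>C (r *\<^sub>R x) = r *\<^sub>R (c *\<^sub>C x)" for r and x :: "'k \<Rightarrow>\<^sub>L 'h"
    by (rule blinfun_eqI) (simp add: scaleC_blinfun.rep_eq blinfun.scaleR_left
        scaleR_scaleC scaleC_scaleC mult.commute)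
  show "norm (c *\<^sub>C x) \<le> norm x * cmod c" for x :: "'k \<Rightarrow>\<^sub>L 'h"
    using norm_scaleC_blinfun_le[of c x] by (simp add: mult.commute)
qed

lemma scaleR_blinfun_scaleC: "r *\<^sub>R T = complex_of_real r *\<^sub>C (T :: 'k::chilbert \<Rightarrow>\<^sub>L 'h::chilbert)"
  by (rule blinfun_eqI) (simp add: scaleC_blinfun.rep_eq blinfun.scaleR_left scaleR_scaleC)

lemma compose_scaleC_left: "(c *\<^sub>C S) o\<^sub>L T = c *\<^sub>C (S o\<^sub>L T)"
  by (rule blinfun_eqI) (simp add: scaleC_blinfun.rep_eq)

lemma compose_scaleC_right: "S \<in> bounded_ops \<Longrightarrow> S o\<^sub>L (c *\<^sub>C T) = c *\<^sub>C (S o\<^sub>L T)"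
  by (rule blinfun_eqI) (simp add: scaleC_blinfun.rep_eq bounded_opsD)

lemma compose_assoc: "(A o\<^sub>L B) o\<^sub>L C = A o\<^sub>L (B o\<^sub>L C)"
  by (rule blinfun_eqI) simp

lemmas compose_add_left = bounded_bilinear.add_left[OF bounded_bilinear_blinfun_compose]
  and compose_add_right = bounded_bilinear.add_right[OF bounded_bilinear_blinfun_compose]
  and compose_diff_left = bounded_bilinear.diff_left[OF bounded_bilinear_blinfun_compose]
  and compose_diff_right = bounded_bilinear.diff_right[OF bounded_bilinear_blinfun_compose]
  and compose_zero_left [simp] = bounded_bilinear.zero_left[OF bounded_bilinear_blinfun_compose]
  and compose_zero_right [simp] = bounded_bilinear.zero_right[OF bounded_bilinear_blinfun_compose]
  and tendsto_compose_op = bounded_bilinear.tendsto[OF bounded_bilinear_blinfun_compose]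

lemma closed_bounded_ops: "closed (bounded_ops :: ('k::chilbert \<Rightarrow>\<^sub>L 'h::chilbert) set)"
proof -
  have *: "bounded_ops = (\<Inter>c. \<Inter>x. {T :: 'k \<Rightarrow>\<^sub>L 'h. T (c *\<^sub>C x) = c *\<^sub>C T x})"
    by (auto simp: bounded_ops_def)
  show ?thesis
    unfolding *
    by (intro closed_INT ballI closed_Collect_eq continuous_intros
        bounded_linear.continuous_on[OF bounded_linear_scaleC])
qed

lemma adj_tendsto:
  fixes f :: "'d \<Rightarrow> ('k::chilbert \<Rightarrow>\<^sub>L 'h::chilbert)"
  assumes f: "(f \<longlongrightarrow> l) F" and b: "\<And>\<alpha>. f \<alpha> \<in> bounded_ops" "l \<in> bounded_ops"
  shows "((\<lambda>\<alpha>. adj (f \<alpha>)) \<longlongrightarrow> adj l) F"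
proof -
  have "norm (adj (f \<alpha>) - adj l) = norm (f \<alpha> - l)" for \<alpha>
    by (simp add: adj_diff[symmetric] b)
  then show ?thesis
    using f by (simp add: tendsto_iff dist_norm)
qed

section \<open>Matrix norms\<close>

lemma op_mnorm_bdd_above:
  "bdd_above ((\<lambda>\<xi>. L2_set (\<lambda>p. norm (\<Sum>q<n. blinfun_apply (x p q) (\<xi> q))) {..<n}) `
     {\<xi> :: nat \<Rightarrow> 'k::chilbert. L2_set (\<lambda>q. norm (\<xi> q)) {..<n} \<le> 1})"
  for x :: "nat \<Rightarrow> nat \<Rightarrow> ('k::chilbert \<Rightarrow>\<^sub>L 'h::chilbert)"
proof (rule bdd_aboveI2)
  fix \<xi> :: "nat \<Rightarrow> 'k"
  assume "\<xi> \<in> {\<xi>. L2_set (\<lambda>q. norm (\<xi> q)) {..<n} \<le> 1}"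
  then have \<xi>: "norm (\<xi> q) \<le> 1" if "q < n" for q
    using member_le_L2_set[of "{..<n}" q "\<lambda>q. norm (\<xi> q)"] that by simp
  have "L2_set (\<lambda>p. norm (\<Sum>q<n. x p q (\<xi> q))) {..<n} \<le> (\<Sum>p<n. norm (\<Sum>q<n. x p q (\<xi> q)))"
    by (rule L2_set_le_sum) simp
  also have "\<dots> \<le> (\<Sum>p<n. \<Sum>q<n. norm (x p q))"
  proof (intro sum_mono order_trans[OF norm_sum])
    fix p q assume "q \<in> {..<n}"
    then have "norm (x p q) * norm (\<xi> q) \<le> norm (x p q) * 1"
      by (intro mult_left_mono \<xi>) auto
    then show "norm (x p q (\<xi> q)) \<le> norm (x p q)" using norm_blinfun[of "x p q" "\<xi> q"] by simp
  qed
  finally show "L2_set (\<lambda>p. norm (\<Sum>q<n. x p q (\<xi> q))) {..<n} \<le> (\<Sum>p<n. \<Sum>q<n. norm (x p q))" .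
qed

lemma op_mnorm_upper:
  fixes x :: "nat \<Rightarrow> nat \<Rightarrow> ('k::chilbert \<Rightarrow>\<^sub>L 'h::chilbert)"
  assumes "L2_set (\<lambda>q. norm (\<xi> q)) {..<n} \<le> 1"
  shows "L2_set (\<lambda>p. norm (\<Sum>q<n. x p q (\<xi> q))) {..<n} \<le> op_mnorm n x"
  unfolding op_mnorm_def by (rule cSUP_upper[OF _ op_mnorm_bdd_above]) (use assms in simp)

lemma op_mnorm_nonneg: "0 \<le> op_mnorm n (x :: nat \<Rightarrow> nat \<Rightarrow> ('k::chilbert \<Rightarrow>\<^sub>L 'h::chilbert))"
  using op_mnorm_upper[of "\<lambda>_. 0" n x] by (auto intro: order_trans[OF L2_set_nonneg] simp: L2_set_0')

lemma op_mnorm_bound: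
  fixes x :: "nat \<Rightarrow> nat \<Rightarrow> ('k::chilbert \<Rightarrow>\<^sub>L 'h::chilbert)"
  shows "L2_set (\<lambda>p. norm (\<Sum>q<n. x p q (\<xi> q))) {..<n} \<le> op_mnorm n x * L2_set (\<lambda>q. norm (\<xi> q)) {..<n}"
proof (cases "L2_set (\<lambda>q. norm (\<xi> q)) {..<n} = 0")
  case True
  then have "\<forall>q<n. \<xi> q = 0" by (simp add: L2_set_eq_0_iff)
  then show ?thesis by (simp add: True L2_set_0')
next
  case False
  define s where "s = L2_set (\<lambda>q. norm (\<xi> q)) {..<n}"
  have s: "0 < s" using False by (simp add: s_def less_le)
  have "L2_set (\<lambda>q. norm ((1/s) *\<^sub>R \<xi> q)) {..<n} = (1/s) * s"
    unfolding s_def by (subst L2_set_right_distrib) (auto simp: s_def[symmetric] s less_imp_le)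
  then have "L2_set (\<lambda>p. norm (\<Sum>q<n. x p q ((1/s) *\<^sub>R \<xi> q))) {..<n} \<le> op_mnorm n x"
    by (intro op_mnorm_upper) (use s in simp)
  also have "(\<lambda>p. norm (\<Sum>q<n. x p q ((1/s) *\<^sub>R \<xi> q))) = (\<lambda>p. (1/s) * norm (\<Sum>q<n. x p q (\<xi> q)))"
    using s by (simp add: blinfun.scaleR_right scaleR_sum_right[symmetric])
  also have "L2_set \<dots> {..<n} = (1/s) * L2_set (\<lambda>p. norm (\<Sum>q<n. x p q (\<xi> q))) {..<n}"
    using s by (subst L2_set_right_distrib) auto
  finally show ?thesis using s by (simp add: s_def[symmetric] field_simps)
qed

lemma op_mnorm_le:
  fixes x :: "nat \<Rightarrow> nat \<Rightarrow> ('k::chilbert \<Rightarrow>\<^sub>L 'h::chilbert)"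
  assumes "0 \<le> M"
    and M: "\<And>\<xi>. L2_set (\<lambda>p. norm (\<Sum>q<n. x p q (\<xi> q))) {..<n} \<le> M * L2_set (\<lambda>q. norm (\<xi> q)) {..<n}"
  shows "op_mnorm n x \<le> M"
  unfolding op_mnorm_def
proof (rule cSUP_least)
  show "{\<xi> :: nat \<Rightarrow> 'k. L2_set (\<lambda>q. norm (\<xi> q)) {..<n} \<le> 1} \<noteq> {}"
    by (auto intro!: exI[of _ "\<lambda>_. 0"] simp: L2_set_0')
  fix \<xi> :: "nat \<Rightarrow> 'k"
  assume "\<xi> \<in> {\<xi>. L2_set (\<lambda>q. norm (\<xi> q)) {..<n} \<le> 1}"
  then have "M * L2_set (\<lambda>q. norm (\<xi> q)) {..<n} \<le> M * 1"
    using \<open>0 \<le> M\<close> by (intro mult_left_mono) auto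
  then show "L2_set (\<lambda>p. norm (\<Sum>q<n. x p q (\<xi> q))) {..<n} \<le> M" using M[of \<xi>] by simp
qed

lemma op_mnorm_cong:
  assumes "\<And>p q. p < n \<Longrightarrow> q < n \<Longrightarrow> x p q = y p q"
  shows "op_mnorm n x = op_mnorm n y"
proof -
  have "L2_set (\<lambda>p. norm (\<Sum>q<n. x p q (\<xi> q))) {..<n} = L2_set (\<lambda>p. norm (\<Sum>q<n. y p q (\<xi> q))) {..<n}" for \<xi>
    using assms by (intro L2_set_cong) auto
  then show ?thesis by (simp add: op_mnorm_def)
qed

lemma op_mnorm_1: "op_mnorm 1 (\<lambda>_ _. T) = norm (T :: 'k::chilbert \<Rightarrow>\<^sub>L 'h::chilbert)"
proof (rule antisym)
  show "op_mnorm 1 (\<lambda>_ _. T) \<le> norm T"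
    by (rule op_mnorm_le) (auto simp: lessThan_Suc norm_blinfun)
  show "norm T \<le> op_mnorm 1 (\<lambda>_ _. T)"
  proof (rule norm_blinfun_bound[OF op_mnorm_nonneg])
    show "norm (T v) \<le> op_mnorm 1 (\<lambda>_ _. T) * norm v" for v
      using op_mnorm_bound[where n = 1 and x = "\<lambda>_ _. T" and \<xi> = "\<lambda>_. v"] by (simp add: lessThan_Suc)
  qed
qed

lemma le_of_square_le_mult:
  fixes a b :: real
  assumes "0 \<le> a" "0 \<le> b" "a * a \<le> a * b"
  shows "a \<le> b"
proof (cases "a = 0")
  case False
  then have "0 < a" using assms(1) by (simp add: order_less_le)
  with assms(3) show ?thesis by (rule mult_left_le_imp_le)
qed (use assms in simp)

lemma sum_inner_le_L2_set:
  fixes a b :: "nat \<Rightarrow> 'a::real_inner"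
  shows "(\<Sum>p<n. inner (a p) (b p)) \<le> L2_set (\<lambda>p. norm (a p)) {..<n} * L2_set (\<lambda>p. norm (b p)) {..<n}"
proof -
  have "(\<Sum>p<n. inner (a p) (b p)) \<le> (\<Sum>p<n. \<bar>norm (a p)\<bar> * \<bar>norm (b p)\<bar>)"
    by (intro sum_mono) (simp add: norm_cauchy_schwarz)
  also have "\<dots> \<le> L2_set (\<lambda>p. norm (a p)) {..<n} * L2_set (\<lambda>p. norm (b p)) {..<n}"
    by (rule L2_set_mult_ineq)
  finally show ?thesis .
qed

lemma L2_set_norm_square:
  fixes a :: "nat \<Rightarrow> 'a::real_inner"
  shows "(L2_set (\<lambda>p. norm (a p)) {..<n})\<^sup>2 = (\<Sum>p<n. inner (a p) (a p))"
  by (simp add: L2_set_def sum_nonneg power2_norm_eq_inner)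

lemma sum_inner_matrix_adj:
  fixes x :: "nat \<Rightarrow> nat \<Rightarrow> ('k::chilbert \<Rightarrow>\<^sub>L 'h::chilbert)"
  assumes "\<And>p q. p < n \<Longrightarrow> q < n \<Longrightarrow> x p q \<in> bounded_ops"
  shows "(\<Sum>p<n. inner (\<Sum>q<n. x p q (\<xi> q)) (\<eta> p)) = (\<Sum>q<n. inner (\<xi> q) (\<Sum>p<n. adj (x p q) (\<eta> p)))"
proof -
  have "(\<Sum>p<n. inner (\<Sum>q<n. x p q (\<xi> q)) (\<eta> p)) = (\<Sum>p<n. \<Sum>q<n. inner (\<xi> q) (adj (x p q) (\<eta> p)))"
    unfolding inner_sum_left by (intro sum.cong refl) (simp add: adj_inner assms)
  also have "\<dots> = (\<Sum>q<n. \<Sum>p<n. inner (\<xi> q) (adj (x p q) (\<eta> p)))" by (rule sum.swap)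
  finally show ?thesis by (simp add: inner_sum_right)
qed

text \<open>The norm of an operator matrix \<open>x\<close> is determined by \<open>x x\<^sup>*\<close>, as it is the square root of
  the norm of \<open>x x\<^sup>*\<close>. The products \<open>x y\<^sup>*\<close> do not see the domain of the entries, so the two
  matrices may act from different spaces.\<close>

lemma op_mnorm_le_of_gram:
  fixes x :: "nat \<Rightarrow> nat \<Rightarrow> ('k::chilbert \<Rightarrow>\<^sub>L 'h::chilbert)"
    and y :: "nat \<Rightarrow> nat \<Rightarrow> ('l::chilbert \<Rightarrow>\<^sub>L 'h)"
  assumes x: "\<And>p q. p < n \<Longrightarrow> q < n \<Longrightarrow> x p q \<in> bounded_ops"
    and y: "\<And>p q. p < n \<Longrightarrow> q < n \<Longrightarrow> y p q \<in> bounded_ops"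
    and gram: "\<And>p p' r. p < n \<Longrightarrow> p' < n \<Longrightarrow> r < n \<Longrightarrow>
      x p r o\<^sub>L adj (x p' r) = y p r o\<^sub>L adj (y p' r)"
  shows "op_mnorm n x \<le> op_mnorm n y"
proof (rule op_mnorm_le[OF op_mnorm_nonneg])
  fix \<xi> :: "nat \<Rightarrow> 'k"
  let ?M = "op_mnorm n y"
  define \<eta> where "\<eta> p = (\<Sum>q<n. x p q (\<xi> q))" for p
  define ax where "ax r = (\<Sum>p<n. adj (x p r) (\<eta> p))" for r
  define ay where "ay r = (\<Sum>p<n. adj (y p r) (\<eta> p))" for r
  have expand: "(\<Sum>r<n. inner (\<Sum>p<n. adj (z p r) (\<eta> p)) (\<Sum>p<n. adj (z p r) (\<eta> p)))
      = (\<Sum>r<n. \<Sum>p<n. \<Sum>p'<n. inner (\<eta> p) ((z p r o\<^sub>L adj (z p' r)) (\<eta> p')))"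
    if "\<And>p q. p < n \<Longrightarrow> q < n \<Longrightarrow> z p q \<in> bounded_ops" for z :: "nat \<Rightarrow> nat \<Rightarrow> ('u::chilbert \<Rightarrow>\<^sub>L 'h)"
  proof (intro sum.cong refl)
    fix r assume "r \<in> {..<n}"
    then have "inner (adj (z p r) (\<eta> p)) w = inner (\<eta> p) (z p r w)" if "p < n" for p w
      using adj_inner[of "z p r" w "\<eta> p"] \<open>p < n\<close> that \<open>\<And>p q. p < n \<Longrightarrow> q < n \<Longrightarrow> z p q \<in> bounded_ops\<close>
      by (simp add: inner_commute)
    then show "inner (\<Sum>p<n. adj (z p r) (\<eta> p)) (\<Sum>p<n. adj (z p r) (\<eta> p))
      = (\<Sum>p<n. \<Sum>p'<n. inner (\<eta> p) ((z p r o\<^sub>L adj (z p' r)) (\<eta> p')))"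
      by (simp add: inner_sum_left blinfun.sum_right inner_sum_right) (rule sum.swap)
  qed
  have "(\<Sum>r<n. inner (ax r) (ax r)) =
      (\<Sum>r<n. \<Sum>p<n. \<Sum>p'<n. inner (\<eta> p) ((x p r o\<^sub>L adj (x p' r)) (\<eta> p')))"
    unfolding ax_def by (rule expand) (rule x)
  also have "\<dots> = (\<Sum>r<n. \<Sum>p<n. \<Sum>p'<n. inner (\<eta> p) ((y p r o\<^sub>L adj (y p' r)) (\<eta> p')))"
    by (intro sum.cong refl) (simp only: gram lessThan_iff)
  also have "\<dots> = (\<Sum>r<n. inner (ay r) (ay r))"
    unfolding ay_def by (rule expand[symmetric]) (rule y)
  finally have "(L2_set (\<lambda>r. norm (ax r)) {..<n})\<^sup>2 = (L2_set (\<lambda>r. norm (ay r)) {..<n})\<^sup>2"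
    unfolding L2_set_norm_square .
  then have ax_ay: "L2_set (\<lambda>r. norm (ax r)) {..<n} = L2_set (\<lambda>r. norm (ay r)) {..<n}"
    by (simp add: power2_eq_iff_nonneg)
  have ay_le: "L2_set (\<lambda>r. norm (ay r)) {..<n} \<le> ?M * L2_set (\<lambda>p. norm (\<eta> p)) {..<n}" (is "?a \<le> ?M * ?h")
  proof -
    have "?a\<^sup>2 = (\<Sum>p<n. inner (\<Sum>r<n. y p r (ay r)) (\<eta> p))"
      unfolding L2_set_norm_square using sum_inner_matrix_adj[of n y ay \<eta>] y by (simp add: ay_def)
    also have "\<dots> \<le> L2_set (\<lambda>p. norm (\<Sum>r<n. y p r (ay r))) {..<n} * ?h" by (rule sum_inner_le_L2_set)
    also have "\<dots> \<le> (?M * ?a) * ?h" by (intro mult_right_mono op_mnorm_bound) simp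
    finally have "?a * ?a \<le> ?a * (?M * ?h)" by (simp add: power2_eq_square mult_ac)
    then show ?thesis by (rule le_of_square_le_mult[rotated 2]) (auto simp: op_mnorm_nonneg)
  qed
  let ?h = "L2_set (\<lambda>p. norm (\<eta> p)) {..<n}" and ?s = "L2_set (\<lambda>q. norm (\<xi> q)) {..<n}"
  have "?h\<^sup>2 = (\<Sum>p<n. inner (\<Sum>q<n. x p q (\<xi> q)) (\<eta> p))"
    unfolding L2_set_norm_square by (simp add: \<eta>_def)
  also have "\<dots> = (\<Sum>q<n. inner (\<xi> q) (ax q))"
    unfolding ax_def by (rule sum_inner_matrix_adj) (rule x)
  also have "\<dots> \<le> ?s * L2_set (\<lambda>r. norm (ax r)) {..<n}" by (rule sum_inner_le_L2_set)
  also have "\<dots> \<le> ?s * (?M * ?h)" unfolding ax_ay by (intro mult_left_mono ay_le) simp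
  finally have "?h * ?h \<le> ?h * (?M * ?s)" by (simp add: power2_eq_square mult_ac)
  then have "?h \<le> ?M * ?s" by (rule le_of_square_le_mult[rotated 2]) (auto simp: op_mnorm_nonneg)
  then show "L2_set (\<lambda>p. norm (\<Sum>q<n. x p q (\<xi> q))) {..<n} \<le> ?M * ?s" by (simp add: \<eta>_def)
qed

section \<open>Triple morphisms are contractive\<close>

lemma triple_systemD:
  assumes "triple_system X"
  shows triple_system_bounded_ops: "x \<in> X \<Longrightarrow> x \<in> bounded_ops"
    and triple_system_csubspace: "csubspace X"
    and triple_system_closed: "closed X"
    and triple_system_triple: "x \<in> X \<Longrightarrow> y \<in> X \<Longrightarrow> z \<in> X \<Longrightarrow> x o\<^sub>L adj y o\<^sub>L z \<in> X"
  using assms by (auto simp: triple_system_def)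

lemma triple_morphismD:
  assumes "triple_morphism X Y \<theta>"
  shows triple_morphism_in: "x \<in> X \<Longrightarrow> \<theta> x \<in> Y"
    and triple_morphism_add: "x \<in> X \<Longrightarrow> y \<in> X \<Longrightarrow> \<theta> (x + y) = \<theta> x + \<theta> y"
    and triple_morphism_scaleC: "x \<in> X \<Longrightarrow> \<theta> (c *\<^sub>C x) = c *\<^sub>C \<theta> x"
    and triple_morphism_triple: "x \<in> X \<Longrightarrow> y \<in> X \<Longrightarrow> z \<in> X \<Longrightarrow>
      \<theta> (x o\<^sub>L adj y o\<^sub>L z) = \<theta> x o\<^sub>L adj (\<theta> y) o\<^sub>L \<theta> z"
  using assms by (auto simp: triple_morphism_def clinear_on_def)

lemma clinear_on_diff:
  assumes "clinear_on X f" "csubspace X" "x \<in> X" "y \<in> X"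
  shows "f (x - y) = f x - f y"
proof -
  have "f (x + (-1) *\<^sub>C y) = f x + (-1) *\<^sub>C f y"
    using assms csubspace_scaleC[OF assms(2), of y "-1"] by (simp add: clinear_on_def)
  then show ?thesis by (simp add: scaleC_minus_one)
qed

text \<open>If \<open>v = c + c c\<^sup>* v\<close> then \<open>1 + v c\<^sup>*\<close> is a right inverse of \<open>1 - c c\<^sup>*\<close>, whereas \<open>1\<close> is an
  approximate eigenvalue of \<open>c c\<^sup>*\<close> when \<open>c\<close> has norm \<open>1\<close>.\<close>

lemma norm_neq_1_of_resolvent:
  fixes c v :: "'h::chilbert \<Rightarrow>\<^sub>L 'h"
  assumes c: "c \<in> bounded_ops" and v: "v = c + (c o\<^sub>L adj c o\<^sub>L v)"
  shows "norm c \<noteq> 1"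
proof
  assume n1: "norm c = 1"
  define R where "R = id_blinfun + (v o\<^sub>L adj c)"
  define L where "L = (norm R)\<^sup>2 + 1"
  have L: "1 \<le> L" by (simp add: L_def)
  have bound: "(norm (adj c h))\<^sup>2 \<le> (1 - 1 / L) * (norm h)\<^sup>2" for h
  proof -
    let ?d = "h - c (adj c h)"
    have v': "v w = c w + c (adj c (v w))" for w
      using arg_cong[OF v, of "\<lambda>s. blinfun_apply s w"] by (simp add: blinfun.add_left)
    have "R h - c (adj c (R h)) = h"
      using v'[of "adj c h"] by (simp add: R_def blinfun.add_left blinfun.add_right)
    then have "(norm h)\<^sup>2 = inner (R h - c (adj c (R h))) h" by (simp add: power2_norm_eq_inner)
    also have "\<dots> = inner (R h) ?d"
      using c by (simp add: inner_diff_left inner_diff_right adj_inner)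
    also have "\<dots> \<le> norm (R h) * norm ?d" by (rule norm_cauchy_schwarz)
    also have "\<dots> \<le> (norm R * norm h) * norm ?d" by (intro mult_right_mono norm_blinfun) simp
    finally have "norm h * norm h \<le> norm h * (norm R * norm ?d)" by (simp add: power2_eq_square mult_ac)
    then have "norm h \<le> norm R * norm ?d"
      by (cases "h = 0") auto
    then have "(norm h)\<^sup>2 \<le> (norm R * norm ?d)\<^sup>2" by (intro power_mono) auto
    also have "\<dots> \<le> L * (norm ?d)\<^sup>2" by (simp add: L_def power_mult_distrib mult_right_mono)
    also have "\<dots> \<le> L * ((norm h)\<^sup>2 - (norm (adj c h))\<^sup>2)"
    proof (rule mult_left_mono)
      have "norm (c (adj c h)) \<le> norm (adj c h)" using norm_blinfun[of c "adj c h"] n1 by simp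
      then have "(norm (c (adj c h)))\<^sup>2 \<le> (norm (adj c h))\<^sup>2" by (intro power_mono) auto
      moreover have "(norm ?d)\<^sup>2 = (norm h)\<^sup>2 - 2 * inner (c (adj c h)) h + (norm (c (adj c h)))\<^sup>2"
        by (simp add: power2_norm_eq_inner inner_diff_left inner_diff_right inner_commute)
      moreover have "inner (c (adj c h)) h = (norm (adj c h))\<^sup>2"
        using c by (simp add: adj_inner power2_norm_eq_inner)
      ultimately show "(norm ?d)\<^sup>2 \<le> (norm h)\<^sup>2 - (norm (adj c h))\<^sup>2" by simp
    qed (use L in simp)
    finally show ?thesis using L by (simp add: field_simps)
  qed
  have "norm (adj c) \<le> sqrt (1 - 1 / L)"
  proof (rule norm_blinfun_bound)
    fix h
    have "(norm (adj c h))\<^sup>2 \<le> (sqrt (1 - 1 / L) * norm h)\<^sup>2"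
      using bound[of h] L by (simp add: power_mult_distrib)
    then show "norm (adj c h) \<le> sqrt (1 - 1 / L) * norm h"
      by (rule power2_le_imp_le) (use L in simp)
  qed (use L in simp)
  also have "\<dots> < 1" using L by simp
  finally show False using n1 c by simp
qed

text \<open>A triple morphism induces a map \<open>x y\<^sup>* \<mapsto> \<theta>(x) \<theta>(y)\<^sup>*\<close> of left \<open>C\<^sup>*\<close>-algebras, and like every
  \<open>*\<close>-homomorphism this map is contractive. The proof adapts the usual spectral argument so
  that it only involves elements of the triple system: if \<open>d = z g\<^sup>*\<close> has norm below \<open>1\<close>, then
  \<open>w = (1 - d d\<^sup>*)\<^sup>-\<^sup>1 z\<close> lies in \<open>Z\<close>, and \<open>\<theta>\<close> transports its defining equation
  \<open>w = z + d d\<^sup>* w\<close>, so that \<open>\<theta>(z) \<theta>(g)\<^sup>*\<close> does not have norm \<open>1\<close>. Scaling \<open>z\<close> then excludes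
  every norm above that of \<open>d\<close>.\<close>

theorem triple_morphism_norm_compose_adj:
  fixes Z :: "('p::chilbert \<Rightarrow>\<^sub>L 'q::chilbert) set" and T :: "('k::chilbert \<Rightarrow>\<^sub>L 'h::chilbert) set"
  assumes Z: "triple_system Z" and T: "triple_system T" and \<theta>: "triple_morphism Z T \<theta>"
    and z: "z \<in> Z" and g: "g \<in> Z"
  shows "norm (\<theta> z o\<^sub>L adj (\<theta> g)) \<le> norm (z o\<^sub>L adj g)"
proof -
  note Zb = triple_system_bounded_ops[OF Z] and Tb = triple_system_bounded_ops[OF T]
    and \<theta>T = triple_morphism_in[OF \<theta>]
  have unit: "norm (\<theta> z o\<^sub>L adj (\<theta> g)) \<noteq> 1" if z: "z \<in> Z" and lt: "norm (z o\<^sub>L adj g) < 1" for z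
  proof -
    define d where "d = z o\<^sub>L adj g"
    define c where "c = \<theta> z o\<^sub>L adj (\<theta> g)"
    have dd: "d o\<^sub>L (adj d o\<^sub>L u) = z o\<^sub>L adj g o\<^sub>L (g o\<^sub>L adj z o\<^sub>L u)" for u :: "'p \<Rightarrow>\<^sub>L 'q"
      by (simp add: d_def adj_compose Zb z g compose_assoc)
    have db: "d \<in> bounded_ops" and cb: "c \<in> bounded_ops"
      by (simp_all add: d_def c_def Zb Tb \<theta>T z g)
    have "\<exists>!w\<in>Z. z + (d o\<^sub>L (adj d o\<^sub>L w)) = w"
    proof (rule Banach_fix)
      show "complete Z" using triple_system_closed[OF Z] by (simp add: complete_eq_closed)
      show "Z \<noteq> {}" using z by blast
      show "(norm d)\<^sup>2 < 1" using lt by (simp add: d_def power_less_one_iff abs_square_less_1)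
      show "(\<lambda>w. z + (d o\<^sub>L (adj d o\<^sub>L w))) ` Z \<subseteq> Z"
        unfolding dd
        by (auto intro!: csubspace_add[OF triple_system_csubspace[OF Z]] triple_system_triple[OF Z] z g)
      show "dist (z + (d o\<^sub>L (adj d o\<^sub>L u))) (z + (d o\<^sub>L (adj d o\<^sub>L w))) \<le> (norm d)\<^sup>2 * dist u w" for u w
      proof -
        have "norm (d o\<^sub>L (adj d o\<^sub>L (u - w))) \<le> norm d * (norm (adj d) * norm (u - w))"
          by (intro order_trans[OF norm_blinfun_compose] mult_left_mono norm_blinfun_compose) simp
        then show ?thesis
          using db by (simp add: dist_norm compose_diff_right power2_eq_square)
      qed
    qed simp
    then obtain w where w: "w \<in> Z" and fix_w: "z + (z o\<^sub>L adj g o\<^sub>L (g o\<^sub>L adj z o\<^sub>L w)) = w"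
      unfolding dd by blast
    note tr = triple_system_triple[OF Z]
    have "\<theta> w = \<theta> (z + (z o\<^sub>L adj g o\<^sub>L (g o\<^sub>L adj z o\<^sub>L w)))" by (simp add: fix_w)
    also have "\<dots> = \<theta> z + (\<theta> z o\<^sub>L adj (\<theta> g) o\<^sub>L (\<theta> g o\<^sub>L adj (\<theta> z) o\<^sub>L \<theta> w))"
      by (simp add: triple_morphism_add[OF \<theta>] triple_morphism_triple[OF \<theta>] z g w tr)
    also have "\<dots> = \<theta> z + (c o\<^sub>L (adj c o\<^sub>L \<theta> w))"
      by (simp add: c_def adj_compose Tb \<theta>T z g compose_assoc)
    finally have "\<theta> w o\<^sub>L adj (\<theta> g) = c + (c o\<^sub>L adj c o\<^sub>L (\<theta> w o\<^sub>L adj (\<theta> g)))"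
      by (metis c_def compose_add_left compose_assoc)
    then show ?thesis using norm_neq_1_of_resolvent[OF cb] by (simp add: c_def)
  qed
  show ?thesis
  proof (rule ccontr)
    let ?r = "norm (\<theta> z o\<^sub>L adj (\<theta> g))"
    assume neg: "\<not> ?thesis"
    then have r: "0 < ?r" using norm_ge_zero[of "z o\<^sub>L adj g"] by linarith
    let ?z = "complex_of_real (1 / ?r) *\<^sub>C z"
    have "?z o\<^sub>L adj g = (1 / ?r) *\<^sub>R (z o\<^sub>L adj g)"
      by (simp only: compose_scaleC_left scaleR_blinfun_scaleC)
    then have "norm (?z o\<^sub>L adj g) < 1" using neg r by (simp add: field_simps)
    moreover have "\<theta> ?z o\<^sub>L adj (\<theta> g) = (1 / ?r) *\<^sub>R (\<theta> z o\<^sub>L adj (\<theta> g))"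
      by (simp only: triple_morphism_scaleC[OF \<theta> z] compose_scaleC_left scaleR_blinfun_scaleC)
    then have "norm (\<theta> ?z o\<^sub>L adj (\<theta> g)) = 1" using r by simp
    ultimately show False
      using unit[of ?z] csubspace_scaleC[OF triple_system_csubspace[OF Z] z] by blast
  qed
qed

corollary triple_morphism_contractive:
  fixes Z :: "('p::chilbert \<Rightarrow>\<^sub>L 'q::chilbert) set" and T :: "('k::chilbert \<Rightarrow>\<^sub>L 'h::chilbert) set"
  assumes Z: "triple_system Z" and T: "triple_system T" and \<theta>: "triple_morphism Z T \<theta>"
    and z: "z \<in> Z"
  shows "norm (\<theta> z) \<le> norm z"
proof -
  have "(norm (\<theta> z))\<^sup>2 \<le> (norm z)\<^sup>2"
    using triple_morphism_norm_compose_adj[OF Z T \<theta> z z]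
    by (simp add: norm_compose_adj triple_system_bounded_ops[OF Z z]
        triple_system_bounded_ops[OF T triple_morphism_in[OF \<theta> z]])
  then show ?thesis by (rule power2_le_imp_le) simp
qed

section \<open>Embedding small Hilbert spaces into \<open>\<ell>\<^sup>2\<close>\<close>

definition closed_cspan :: "'a::complex_inner set \<Rightarrow> 'a set" where
  "closed_cspan S = (\<lambda>M. csubspace M \<and> closed M) hull S"

lemma csubspace_closed_cspan: "csubspace (closed_cspan S)"
  and closed_closed_cspan: "closed (closed_cspan S)"
  by (auto simp: closed_cspan_def hull_def csubspace_iff intro!: closed_Inter)

lemma closed_cspan_superset: "S \<subseteq> closed_cspan S"
  by (simp add: closed_cspan_def hull_subset)

lemma closed_cspan_minimal: "S \<subseteq> M \<Longrightarrow> csubspace M \<Longrightarrow> closed M \<Longrightarrow> closed_cspan S \<subseteq> M"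
  by (simp add: closed_cspan_def hull_minimal)

lemma closed_cspan_mono: "S \<subseteq> S' \<Longrightarrow> closed_cspan S \<subseteq> closed_cspan S'"
  by (simp add: closed_cspan_def hull_mono)

lemma closed_cspan_maps_into:
  fixes A :: "'p::chilbert \<Rightarrow>\<^sub>L 'q::chilbert"
  assumes A: "A \<in> bounded_ops" and M: "csubspace M" "closed M" and S: "\<And>x. x \<in> S \<Longrightarrow> A x \<in> M"
    and x: "x \<in> closed_cspan S"
  shows "A x \<in> M"
proof -
  have "closed_cspan S \<subseteq> A -` M"
  proof (rule closed_cspan_minimal)
    show "csubspace (A -` M)"
      using M(1) by (auto simp: csubspace_iff blinfun.add_right bounded_opsD[OF A])
    show "closed (A -` M)"
      by (intro continuous_closed_vimage M(2)) (intro continuous_intros)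
  qed (use S in auto)
  then show ?thesis using x by blast
qed

lemma cinner_scaleC_right: "cinner x (c *\<^sub>C y) = cnj c * cinner x (y::'a::complex_inner)"
  by (metis cinner_commute cinner_scaleC_left complex_cnj_mult)

lemma cinner_self: "cinner x x = complex_of_real ((norm (x::'a::complex_inner))\<^sup>2)"
proof -
  have "Im (cinner x x) = 0"
    using cinner_commute[of x x] by (metis Reals_cnj_iff complex_is_Real_iff)
  then show ?thesis
    by (simp add: complex_eq_iff power2_norm_eq_inner inner_eq_Re_cinner)
qed

lemma cinner_eq_0_of_orthogonal:
  fixes x :: "'a::complex_inner"
  assumes "csubspace M" "\<And>y. y \<in> M \<Longrightarrow> inner x y = 0" "y \<in> M"
  shows "cinner x y = 0"
  using assms csubspace_scaleC[OF assms(1,3), of \<i>]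
  by (simp add: cinner_eq_Complex_inner Complex_eq)

lemma bessel_inequality:
  fixes b :: "'i \<Rightarrow> 'a::complex_inner"
  assumes orth: "\<And>s t. s \<noteq> t \<Longrightarrow> cinner (b s) (b t) = 0" and nb: "\<And>s. norm (b s) \<le> 1"
    and F: "finite F"
  shows "(\<Sum>s\<in>F. (cmod (cinner x (b s)))\<^sup>2) \<le> (norm x)\<^sup>2"
proof -
  define c where "c s = cinner x (b s)" for s
  define y where "y = (\<Sum>s\<in>F. c s *\<^sub>C b s)"
  have xb: "inner x (c s *\<^sub>C b s) = (cmod (c s))\<^sup>2" for s
  proof -
    have "inner x (c s *\<^sub>C b s) = Re (c s * cnj (c s))"
      by (simp add: inner_eq_Re_cinner cinner_scaleC_right c_def mult.commute)
    then show ?thesis by (simp only: complex_norm_square[symmetric] Re_complex_of_real)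
  qed
  have bb: "inner (c s *\<^sub>C b s) (c t *\<^sub>C b t) = (if s = t then (cmod (c s) * norm (b s))\<^sup>2 else 0)" for s t
    by (auto simp: power2_norm_eq_inner[symmetric] norm_scaleC)
      (simp add: inner_eq_Re_cinner cinner_scaleC_right cinner_scaleC_left orth)
  have "inner x y = (\<Sum>s\<in>F. (cmod (c s))\<^sup>2)" by (simp add: y_def inner_sum_right xb)
  moreover have "inner y y = (\<Sum>s\<in>F. (cmod (c s) * norm (b s))\<^sup>2)"
    unfolding y_def inner_sum_left inner_sum_right by (simp add: bb F)
  moreover have "\<dots> \<le> (\<Sum>s\<in>F. (cmod (c s))\<^sup>2)"
    by (intro sum_mono power_mono) (auto intro: mult_left_le nb)
  moreover have "0 \<le> inner (x - y) (x - y)" by simp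
  ultimately show ?thesis
    by (simp add: inner_diff_left inner_diff_right inner_commute[of y x] power2_norm_eq_inner c_def)
qed

lemma adj_self_compose_fixes_isometric:
  fixes U :: "'p::chilbert \<Rightarrow>\<^sub>L 'q::chilbert"
  assumes U: "U \<in> bounded_ops" "norm U \<le> 1" and x: "norm x \<le> norm (U x)"
  shows "adj U (U x) = x"
proof -
  have "norm (adj U (U x)) \<le> norm (U x)"
    using norm_blinfun[of "adj U" "U x"] U mult_right_mono[of "norm U" 1 "norm (U x)"] by simp
  then have "(norm (adj U (U x)))\<^sup>2 \<le> (norm (U x))\<^sup>2" "(norm x)\<^sup>2 \<le> (norm (U x))\<^sup>2"
    using x by (auto intro: power_mono)
  moreover have "(norm (adj U (U x) - x))\<^sup>2 = (norm (adj U (U x)))\<^sup>2 - 2 * (norm (U x))\<^sup>2 + (norm x)\<^sup>2"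
    using adj_inner[OF U(1), of x "U x"]
    by (simp add: power2_norm_eq_inner inner_diff_left inner_diff_right inner_commute)
  ultimately have "(norm (adj U (U x) - x))\<^sup>2 \<le> 0" by linarith
  then show ?thesis by simp
qed

text \<open>The Gram--Schmidt process along a well-ordering of \<open>'a\<close> (normalising the
  difference of \<open>v s\<close> and its projection to the closed span of the preceding vectors, which gives
  the zero vector if \<open>v s\<close> lies there) yields an orthonormal basis, padded with zeros and indexed by \<open>'a\<close> itself,
  so that no dimension has to be computed.\<close>

lemma ell2_partial_isometry:
  fixes v :: "'a \<Rightarrow> 'p::chilbert"
  obtains U :: "'p \<Rightarrow>\<^sub>L 'a ell2"
  where "U \<in> bounded_ops" "norm U \<le> 1"
    and "\<And>x. x \<in> closed_cspan (range v) \<Longrightarrow> adj U (U x) = x"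
    and "\<And>y. adj U y \<in> closed_cspan (range v)"
proof -
  let ?P = "closed_cspan (range v)"
  from well_ordering obtain R :: "'a rel" where "Well_order R \<and> Field R = UNIV" ..
  then have "well_order_on UNIV R" by metis
  then have wf: "wf (R - Id)" and tot: "total_on UNIV R" and tr: "trans R" and anti: "antisym R"
    unfolding well_order_on_def linear_order_on_def partial_order_on_def preorder_on_def by simp_all
  define M where "M s = closed_cspan (v ` {t. (t, s) \<in> R - Id})" for s
  have Ms: "csubspace (M s)" "closed (M s)" for s
    by (simp_all add: M_def csubspace_closed_cspan closed_closed_cspan)
  have M_mono: "M t \<subseteq> M s" if "(t, s) \<in> R - Id" for s t
  proof -
    have "(r, s) \<in> R - Id" if "(r, t) \<in> R - Id" for r
      using that \<open>(t, s) \<in> R - Id\<close> transD[OF tr, of r t s] antisymD[OF anti, of s t] by blast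
    then show ?thesis unfolding M_def by (intro closed_cspan_mono image_mono) blast
  qed
  have MP: "M s \<subseteq> ?P" for s unfolding M_def by (intro closed_cspan_mono) auto
  have "\<forall>s. \<exists>m\<in>M s. \<forall>y\<in>M s. inner (v s - m) y = 0"
    using orthogonal_projection_exists[OF csubspace_imp_subspace] Ms by blast
  then obtain m where m: "\<And>s. m s \<in> M s" and orth: "\<And>s y. y \<in> M s \<Longrightarrow> inner (v s - m s) y = 0"
    by metis
  define b where "b s = sgn (v s - m s)" for s
  have vb: "v s = m s + norm (v s - m s) *\<^sub>R b s" for s
    by (cases "v s = m s") (simp_all add: b_def sgn_div_norm)
  have b_in: "b s \<in> N" if "v s \<in> N" "m s \<in> N" "csubspace N" for s N
    using that by (simp add: b_def sgn_div_norm scaleR_scaleC csubspace_scaleC csubspace_diff)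
  have bP: "b s \<in> ?P" for s
    using closed_cspan_superset[of "range v"] MP[of s] m[of s]
    by (intro b_in csubspace_closed_cspan) auto
  have nb: "norm (b s) = 0 \<or> norm (b s) = 1" for s by (simp add: b_def norm_sgn)
  have b_M: "cinner (b s) y = 0" if "y \<in> M s" for s y
    by (rule cinner_eq_0_of_orthogonal[OF Ms(1) _ that])
      (simp add: b_def sgn_div_norm orth)
  have b_less: "cinner (b s) (b t) = 0" if "(t, s) \<in> R - Id" for s t
  proof (rule b_M, rule b_in)
    have "v t \<in> v ` {t. (t, s) \<in> R - Id}" using that by (intro imageI CollectI)
    then show "v t \<in> M s" unfolding M_def by (rule subsetD[OF closed_cspan_superset])
  qed (use M_mono[OF that] m Ms in auto)
  have b_orth: "cinner (b s) (b t) = 0" if "s \<noteq> t" for s t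
  proof -
    have "(t, s) \<in> R - Id \<or> (s, t) \<in> R - Id" using tot that by (auto simp: total_on_def)
    then show ?thesis using b_less cinner_commute[of "b s" "b t"] by auto
  qed
  have bes: "(\<Sum>s\<in>F. (cmod (cinner x (b s)))\<^sup>2) \<le> (norm x)\<^sup>2" if "finite F" for x F
    by (rule bessel_inequality[OF b_orth _ that]) (simp_all add: b_def norm_sgn)
  have summ: "(\<lambda>s. (cmod (cinner x (b s)))\<^sup>2) summable_on UNIV" for x
    by (rule nonneg_bdd_above_summable_on) (auto intro!: bdd_aboveI2[where M = "(norm x)\<^sup>2"] bes)
  define u where "u x = Abs_ell2 (\<lambda>s. cinner x (b s))" for x
  have u: "ell2_coord (u x) = (\<lambda>s. cinner x (b s))" for x
    unfolding u_def using summ by (simp add: Abs_ell2_inverse)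
  have norm_u: "norm (u x) \<le> norm x" for x
  proof -
    have "(norm (u x))\<^sup>2 \<le> (norm x)\<^sup>2"
      unfolding ell2_norm_square u by (rule infsum_le_finite_sums[OF summ bes])
    then show ?thesis by (rule power2_le_imp_le) simp
  qed
  have u_add: "u (x + y) = u x + u y" for x y
    by (rule ell2_coord_inject[THEN iffD1]) (simp add: u plus_ell2.rep_eq cinner_add_left)
  have u_scaleC: "u (c *\<^sub>C x) = c *\<^sub>C u x" for c x
    by (rule ell2_coord_inject[THEN iffD1]) (simp add: u scaleC_ell2.rep_eq cinner_scaleC_left)
  have "bounded_linear u"
    by (rule bounded_linear_intro[where K = 1]) (auto simp: u_add scaleR_scaleC u_scaleC norm_u)
  then have Bu: "blinfun_apply (Blinfun u) = u" by (rule bounded_linear_Blinfun_apply)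
  define U where "U = Blinfun u"
  have Ub: "U \<in> bounded_ops" by (simp add: bounded_ops_def U_def Bu u_scaleC)
  have U1: "norm U \<le> 1" by (rule norm_blinfun_bound) (simp_all add: U_def Bu norm_u)
  define D where "D = {x. adj U (U x) = x}"
  have D: "csubspace D"
    by (simp add: D_def csubspace_iff blinfun.add_right bounded_opsD Ub)
  have "closed D"
    unfolding D_def by (intro closed_Collect_eq continuous_intros)
  have bD: "b s \<in> D" for s
  proof -
    have "(norm (b s))\<^sup>2 \<le> norm (U (b s))"
      using ell2_finite_sum_le_norm[of "{s}" "U (b s)"]
      by - (rule power2_le_imp_le[OF _ norm_ge_zero], simp add: U_def Bu u cinner_self norm_power)
    then have "norm (b s) \<le> norm (U (b s))" using nb[of s] by auto
    then show ?thesis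
      unfolding D_def using adj_self_compose_fixes_isometric[OF Ub U1] by simp
  qed
  have vD: "v s \<in> D" for s
  proof (induction s rule: wf_induct_rule[OF wf])
    case (1 s)
    then have "M s \<subseteq> D" unfolding M_def by (intro closed_cspan_minimal D \<open>closed D\<close>) auto
    then have "m s + complex_of_real (norm (v s - m s)) *\<^sub>C b s \<in> D"
      using m by (intro csubspace_add[OF D] csubspace_scaleC[OF D] bD) auto
    then show ?case using vb[of s] by (simp add: scaleR_scaleC)
  qed
  show thesis
  proof (rule that[OF Ub U1])
    fix x assume "x \<in> ?P"
    moreover have "?P \<subseteq> D" by (intro closed_cspan_minimal D \<open>closed D\<close>) (use vD in auto)
    ultimately show "adj U (U x) = x" by (auto simp: D_def)
  next
    fix y
    obtain p where p: "p \<in> ?P" and orth_p: "\<And>z. z \<in> ?P \<Longrightarrow> inner (adj U y - p) z = 0"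
      using orthogonal_projection_exists[OF csubspace_imp_subspace[OF csubspace_closed_cspan]
          closed_closed_cspan] by blast
    let ?r = "adj U y - p"
    have "cinner ?r (b s) = 0" for s
      by (rule cinner_eq_0_of_orthogonal[OF csubspace_closed_cspan orth_p bP])
    then have "U ?r = 0"
      by (intro ell2_coord_inject[THEN iffD1]) (simp add: U_def Bu u zero_ell2.rep_eq)
    then have "inner ?r ?r = 0"
      using adj_inner[OF Ub, of ?r y] orth_p[OF p] by (simp add: inner_diff_right)
    then show "adj U y \<in> ?P" using p by simp
  qed
qed

section \<open>Families of the cardinality of an infinite type\<close>

lemma infinite_prod_lepoll:
  assumes "infinite (UNIV :: 'a set)"
  shows "(UNIV :: ('a \<times> 'a) set) \<lesssim> (UNIV :: 'a set)"
  using card_of_ordIso[THEN iffD2, OF card_of_Times_same_infinite[OF assms]]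
  by (auto simp: lepoll_def bij_betw_def)

lemma infinite_prod_lepoll':
  assumes "infinite (UNIV :: 'a set)"
    and "(UNIV :: 'b set) \<lesssim> (UNIV :: 'a set)" and "(UNIV :: 'c set) \<lesssim> (UNIV :: 'a set)"
  shows "(UNIV :: ('b \<times> 'c) set) \<lesssim> (UNIV :: 'a set)"
  using lepoll_trans[OF times_lepoll_mono[OF assms(2,3)]] infinite_prod_lepoll[OF assms(1)] by simp

lemma infinite_list_lepoll:
  assumes inf: "infinite (UNIV :: 'a set)" and B: "(UNIV :: 'b set) \<lesssim> (UNIV :: 'a set)"
  shows "(UNIV :: 'b list set) \<lesssim> (UNIV :: 'a set)"
proof -
  obtain c :: "'a \<times> 'a \<Rightarrow> 'a" where c: "inj c"
    using infinite_prod_lepoll[OF inf] by (auto simp: lepoll_def)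
  obtain d :: "nat \<Rightarrow> 'a" where d: "inj d"
    using infinite_countable_subset[OF inf] by blast
  define code where "code xs = foldr (\<lambda>x r. c (x, r)) xs undefined" for xs
  have code: "xs = ys" if "length xs = length ys" "code xs = code ys" for xs ys :: "'a list"
    using that by (induction rule: list_induct2) (auto simp: code_def dest!: injD[OF c])
  have "inj (\<lambda>xs. c (d (length xs), code xs))"
    by (intro injI code) (auto dest!: injD[OF c] injD[OF d])
  then have "(UNIV :: 'a list set) \<lesssim> (UNIV :: 'a set)" by (auto simp: lepoll_def)
  then show ?thesis using lepoll_trans[OF lists_lepoll_mono[OF B]] by simp
qed

lemma range_reindex:
  fixes g :: "'b \<Rightarrow> 'c"
  assumes "(UNIV :: 'b set) \<lesssim> (UNIV :: 'a set)"
  obtains v :: "'a \<Rightarrow> 'c" where "range v = range g"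
proof -
  obtain f :: "'b \<Rightarrow> 'a" where "inj f" using assms by (auto simp: lepoll_def)
  then have "range (g \<circ> inv f) = range g"
    by (metis image_comp inj_imp_surj_inv)
  then show thesis by (rule that)
qed

section \<open>Triple systems generated by sets\<close>

lemma triple_system_bounded_ops_UNIV: "triple_system (bounded_ops :: ('k::chilbert \<Rightarrow>\<^sub>L 'h::chilbert) set)"
  by (simp add: triple_system_def csubspace_bounded_ops closed_bounded_ops)

lemma triple_system_hull:
  fixes S :: "('k::chilbert \<Rightarrow>\<^sub>L 'h::chilbert) set"
  assumes "S \<subseteq> bounded_ops"
  shows "triple_system (triple_system hull S)"
proof -
  have "triple_system hull S \<subseteq> bounded_ops"
    using assms triple_system_bounded_ops_UNIV by (rule hull_minimal)
  then show ?thesis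
    unfolding triple_system_def
    by (auto simp: hull_def csubspace_iff triple_system_def intro!: closed_Inter)
qed

lemma triple_extensionD:
  assumes "triple_extension N T i"
  shows triple_extension_system: "triple_system T"
    and triple_extension_in: "i a \<in> T"
    and triple_extension_clinear: "clinear_on UNIV i"
    and triple_extension_isometry: "complete_isometry UNIV N op_mnorm i"
    and triple_extension_minimal: "triple_subspace T W \<Longrightarrow> range i \<subseteq> W \<Longrightarrow> W = T"
  using assms by (auto simp: triple_extension_def)

lemma triple_extension_norm:
  assumes "triple_extension N T i"
  shows "norm (i a) = N 1 (\<lambda>_ _. a)"
proof -
  have "op_mnorm 1 (\<lambda>p q. i a) = N 1 (\<lambda>_ _. a)"
    using triple_extension_isometry[OF assms] by (simp add: complete_isometry_def)
  then show ?thesis unfolding op_mnorm_1 .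
qed

text \<open>The minimality clause of a triple extension, in the form in which properties pass from the
  generators \<open>i a\<close> to all of \<open>T\<close>.\<close>

lemma triple_extension_induct:
  assumes ext: "triple_extension N T i" and x: "x \<in> T"
    and base: "\<And>a. P (i a)"
    and sub: "csubspace {x \<in> T. P x}" "closed {x \<in> T. P x}"
    and tri: "\<And>x y z. x \<in> T \<Longrightarrow> y \<in> T \<Longrightarrow> z \<in> T \<Longrightarrow> P x \<Longrightarrow> P y \<Longrightarrow> P z \<Longrightarrow>
      P (x o\<^sub>L adj y o\<^sub>L z)"
  shows "P x"
proof -
  note T = triple_extension_system[OF ext]
  have "triple_subspace T {x \<in> T. P x}"
    unfolding triple_subspace_def triple_system_def
    using sub tri triple_system_bounded_ops[OF T] triple_system_triple[OF T] by blast
  then have "{x \<in> T. P x} = T"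
    using triple_extension_in[OF ext] base by (intro triple_extension_minimal[OF ext]) auto
  then show ?thesis using x by blast
qed

section \<open>Compressing a triple extension to \<open>\<ell>\<^sup>2\<close>\<close>

lemma infinite_UNIV_of_nonzero:
  fixes a :: "'a::complex_vector"
  assumes "a \<noteq> 0" shows "infinite (UNIV :: 'a set)"
proof -
  have "inj (\<lambda>c. c *\<^sub>C a)"
  proof (rule injI, rule ccontr)
    fix c d assume eq: "c *\<^sub>C a = d *\<^sub>C a" and ne: "c \<noteq> d"
    have "(c - d) *\<^sub>C a = 0" using eq scaleC_add_left[of "c - d" d a] by simp
    then have "(inverse (c - d) * (c - d)) *\<^sub>C a = 0" by (simp add: scaleC_scaleC[symmetric])
    then show False using ne assms by (simp add: scaleC_one)
  qed
  moreover have "infinite (UNIV :: complex set)" by (rule infinite_UNIV_char_0)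
  ultimately show ?thesis by (meson finite_imageD finite_subset subset_UNIV)
qed

text \<open>The vectors \<open>\<xi> n X m\<close> nearly attain the norm of the \<open>n \<times> n\<close> matrix with entries in the
  list of lists \<open>X\<close>. Together with all their images under words in \<open>k a\<close> and its adjoints they
  span closed subspaces \<open>P\<close> and \<open>Q\<close> such that \<open>Z\<close> maps \<open>P\<close> into \<open>Q\<close> and its adjoints map \<open>Q\<close> into
  \<open>P\<close>, and these subspaces see all matrix norms. The vectors are indexed by tuples of lists over \<open>'a\<close> and
  numbers, of which there are no more than elements of the infinite type \<open>'a\<close>. By the invariance,
  compression to \<open>P\<close> and \<open>Q\<close> respects triple products.\<close>

proposition triple_extension_compress:
  fixes N :: "nat \<Rightarrow> (nat \<Rightarrow> nat \<Rightarrow> 'a::complex_vector) \<Rightarrow> real"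
    and Z :: "('p::chilbert \<Rightarrow>\<^sub>L 'q::chilbert) set"
  assumes inf: "infinite (UNIV :: 'a set)" and ext: "triple_extension N Z k"
  obtains Z' :: "('a ell2 \<Rightarrow>\<^sub>L 'a ell2) set" and \<kappa>
  where "triple_morphism Z Z' \<kappa>" "triple_extension N Z' (\<lambda>a. \<kappa> (k a))"
proof -
  note Z = triple_extension_system[OF ext]
  note Zb = triple_system_bounded_ops[OF Z] and kZ = triple_extension_in[OF ext]
  have kb: "k a \<in> bounded_ops" for a using Zb kZ .
  have iso: "op_mnorm n (\<lambda>p q. k (x p q)) = N n x" if "n \<ge> 1" for n x
    using triple_extension_isometry[OF ext] that by (simp add: complete_isometry_def)

  define near_max where "near_max n X m \<xi> \<longleftrightarrow> L2_set (\<lambda>q. norm (\<xi> q)) {..<n} \<le> 1 \<and>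
      op_mnorm n (\<lambda>p q. k (X ! p ! q)) - inverse (real (Suc m))
        < L2_set (\<lambda>p. norm (\<Sum>q<n. k (X ! p ! q) (\<xi> q))) {..<n}"
    for n m and X :: "'a list list" and \<xi>
  have "\<exists>\<xi>. near_max n X m \<xi>" for n m and X :: "'a list list"
  proof -
    let ?x = "\<lambda>p q. k (X ! p ! q)"
    have ne: "{\<xi> :: nat \<Rightarrow> 'p. L2_set (\<lambda>q. norm (\<xi> q)) {..<n} \<le> 1} \<noteq> {}"
      by (auto intro!: exI[of _ "\<lambda>_. 0"] simp: L2_set_0')
    have "\<exists>\<xi>\<in>{\<xi>. L2_set (\<lambda>q. norm (\<xi> q)) {..<n} \<le> 1}. op_mnorm n ?x - inverse (real (Suc m))
        < L2_set (\<lambda>p. norm (\<Sum>q<n. ?x p q (\<xi> q))) {..<n}"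
      by (rule less_cSUP_iff[THEN iffD1, OF ne op_mnorm_bdd_above]) (simp add: op_mnorm_def)
    then show ?thesis unfolding Bex_def mem_Collect_eq near_max_def .
  qed
  then obtain \<xi> where "\<And>n X m. near_max n X m (\<xi> n X m)" by metis
  then have \<xi>1: "\<And>n X m. L2_set (\<lambda>q. norm (\<xi> n X m q)) {..<n} \<le> 1"
    and \<xi>: "\<And>n X m. op_mnorm n (\<lambda>p q. k (X ! p ! q)) - inverse (real (Suc m))
        < L2_set (\<lambda>p. norm (\<Sum>q<n. k (X ! p ! q) (\<xi> n X m q))) {..<n}"
    unfolding near_max_def by blast+

  define word where "word ws v = foldr (\<lambda>(a, b) v. adj (k a) (k b v)) ws v"
    for ws :: "('a \<times> 'a) list" and v
  define gp where "gp = (\<lambda>(ws, X, n, m, q). word ws (\<xi> n X m q))"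
  define gq where "gq = (\<lambda>(b, s). k b (gp s))"
  have nat_le: "(UNIV :: nat set) \<lesssim> (UNIV :: 'a set)"
    using inf infinite_le_lepoll by blast
  note le = infinite_prod_lepoll'[OF inf] infinite_list_lepoll[OF inf] nat_le lepoll_refl
  have le_p: "(UNIV :: (('a \<times> 'a) list \<times> 'a list list \<times> nat \<times> nat \<times> nat) set) \<lesssim> (UNIV :: 'a set)"
    by (intro le)
  have le_q: "(UNIV :: ('a \<times> ('a \<times> 'a) list \<times> 'a list list \<times> nat \<times> nat \<times> nat) set) \<lesssim> (UNIV :: 'a set)"
    by (intro le)
  obtain vp :: "'a \<Rightarrow> 'p" where vp: "range vp = range gp" by (rule range_reindex[OF le_p])
  obtain vq :: "'a \<Rightarrow> 'q" where vq: "range vq = range gq" by (rule range_reindex[OF le_q])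
  define P where "P = closed_cspan (range gp)"
  define Q where "Q = closed_cspan (range gq)"
  have P: "csubspace P" "closed P" and Q: "csubspace Q" "closed Q"
    by (simp_all add: P_def Q_def csubspace_closed_cspan closed_closed_cspan)
  have gp_P: "gp s \<in> P" for s unfolding P_def by (rule subsetD[OF closed_cspan_superset]) simp
  have gq_Q: "gq s \<in> Q" for s unfolding Q_def by (rule subsetD[OF closed_cspan_superset]) simp
  have \<xi>_P: "\<xi> n X m q \<in> P" for n X m q
    using gp_P[of "([], X, n, m, q)"] by (simp add: gp_def word_def)
  have kP: "k b x \<in> Q" if "x \<in> P" for b x
  proof (rule closed_cspan_maps_into[OF kb Q _ that[unfolded P_def]])
    fix y assume "y \<in> range gp"
    then obtain s where "y = gp s" by blast
    then show "k b y \<in> Q" using gq_Q[of "(b, s)"] by (simp add: gq_def)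
  qed
  have kQ: "adj (k a) x \<in> P" if "x \<in> Q" for a x
  proof (rule closed_cspan_maps_into[OF adj_bounded_ops[OF kb] P _ that[unfolded Q_def]])
    fix y assume "y \<in> range gq"
    then obtain b ws X n m q where "y = k b (word ws (\<xi> n X m q))" by (auto simp: gq_def gp_def)
    then show "adj (k a) y \<in> P"
      using gp_P[of "((a, b) # ws, X, n, m, q)"] by (simp add: gp_def word_def)
  qed
  have inv: "(\<forall>x\<in>P. z x \<in> Q) \<and> (\<forall>y\<in>Q. adj z y \<in> P)" if "z \<in> Z" for z
  proof (rule triple_extension_induct[OF ext that])
    show "(\<forall>x\<in>P. k a x \<in> Q) \<and> (\<forall>y\<in>Q. adj (k a) y \<in> P)" for a using kP kQ by blast
    show "csubspace {z \<in> Z. (\<forall>x\<in>P. z x \<in> Q) \<and> (\<forall>y\<in>Q. adj z y \<in> P)}"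
      using P(1) Q(1) triple_system_csubspace[OF Z]
      by (auto simp: csubspace_iff blinfun.add_left scaleC_blinfun.rep_eq adj_add adj_scaleC Zb
          adj_unique[of "0 :: 'p \<Rightarrow>\<^sub>L 'q" 0])
    have "{z \<in> Z. (\<forall>x\<in>P. z x \<in> Q) \<and> (\<forall>y\<in>Q. adj z y \<in> P)}
        = Z \<inter> (\<Inter>x\<in>P. (\<lambda>z. blinfun_apply z x) -` Q) \<inter> {z \<in> Z. \<forall>y\<in>Q. adj z y \<in> P}" by auto
    moreover have "closed (\<Inter>x\<in>P. (\<lambda>z. blinfun_apply z x) -` Q)"
      by (intro closed_INT ballI continuous_closed_vimage Q(2)) (intro continuous_intros)
    moreover have "closed {z \<in> Z. \<forall>y\<in>Q. adj z y \<in> P}"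
      unfolding closed_sequential_limits
    proof (intro allI impI, elim conjE)
      fix f l assume f: "\<forall>n. f n \<in> {z \<in> Z. \<forall>y\<in>Q. adj z y \<in> P}" and lim: "f \<longlonglongrightarrow> l"
      have l: "l \<in> Z" using closed_sequentially[OF triple_system_closed[OF Z] _ lim] f by blast
      have "(\<lambda>n. adj (f n)) \<longlonglongrightarrow> adj l" by (rule adj_tendsto[OF lim]) (use f l Zb in auto)
      then have "(\<lambda>n. adj (f n) y) \<longlonglongrightarrow> adj l y" for y
        by (intro blinfun.tendsto tendsto_const)
      then have "adj l y \<in> P" if "y \<in> Q" for y
        by (rule closed_sequentially[OF P(2), rotated]) (use f that in blast)
      then show "l \<in> {z \<in> Z. \<forall>y\<in>Q. adj z y \<in> P}" using l by blast
    qed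
    ultimately show "closed {z \<in> Z. (\<forall>x\<in>P. z x \<in> Q) \<and> (\<forall>y\<in>Q. adj z y \<in> P)}"
      using triple_system_closed[OF Z] by (simp only: closed_Int)
    show "(\<forall>v\<in>P. (x o\<^sub>L adj y o\<^sub>L z) v \<in> Q) \<and> (\<forall>v\<in>Q. adj (x o\<^sub>L adj y o\<^sub>L z) v \<in> P)"
      if "x \<in> Z" "y \<in> Z" "z \<in> Z" "(\<forall>v\<in>P. x v \<in> Q) \<and> (\<forall>v\<in>Q. adj x v \<in> P)"
        "(\<forall>v\<in>P. y v \<in> Q) \<and> (\<forall>v\<in>Q. adj y v \<in> P)" "(\<forall>v\<in>P. z v \<in> Q) \<and> (\<forall>v\<in>Q. adj z v \<in> P)"
      for x y z
      using that by (simp add: adj_compose Zb)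
  qed

  obtain U :: "'p \<Rightarrow>\<^sub>L 'a ell2" where U: "U \<in> bounded_ops" "norm U \<le> 1"
    and UU: "\<And>x. x \<in> P \<Longrightarrow> adj U (U x) = x" and UP: "\<And>y. adj U y \<in> P"
    by (rule ell2_partial_isometry[of vp]) (simp add: vp P_def)
  obtain W :: "'q \<Rightarrow>\<^sub>L 'a ell2" where W: "W \<in> bounded_ops" "norm W \<le> 1"
    and WW: "\<And>x. x \<in> Q \<Longrightarrow> adj W (W x) = x"
    by (rule ell2_partial_isometry[of vq]) (simp add: vq Q_def)
  have contr: "norm (B x) \<le> norm x" if "norm B \<le> 1" for B :: "'u::chilbert \<Rightarrow>\<^sub>L 'v::chilbert" and x
    using order_trans[OF norm_blinfun mult_right_mono[OF that norm_ge_zero]] by simp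
  have W_iso: "norm (W x) = norm x" if "x \<in> Q" for x
    using adj_inner[OF W(1), of x "W x"] WW[OF that] by (simp add: norm_eq_sqrt_inner)

  define \<kappa> where "\<kappa> z = W o\<^sub>L z o\<^sub>L adj U" for z
  define Z' where "Z' = triple_system hull (range (\<lambda>a. \<kappa> (k a)))"
  have \<kappa>_add: "\<kappa> (x + y) = \<kappa> x + \<kappa> y" for x y
    by (simp add: \<kappa>_def compose_add_left compose_add_right)
  have \<kappa>_scaleC: "\<kappa> (c *\<^sub>C x) = c *\<^sub>C \<kappa> x" for c x
    by (simp add: \<kappa>_def compose_scaleC_left compose_scaleC_right W)
  have \<kappa>_bounded: "\<kappa> z \<in> bounded_ops" if "z \<in> Z" for z
    using that by (simp add: \<kappa>_def U W Zb)
  have \<kappa>_triple: "\<kappa> (x o\<^sub>L adj y o\<^sub>L z) = \<kappa> x o\<^sub>L adj (\<kappa> y) o\<^sub>L \<kappa> z"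
    if "x \<in> Z" "y \<in> Z" "z \<in> Z" for x y z
  proof (rule blinfun_eqI)
    fix h
    have "z (adj U h) \<in> Q" and "adj y (z (adj U h)) \<in> P"
      using inv[OF that(3)] inv[OF that(2)] UP by blast+
    then show "\<kappa> (x o\<^sub>L adj y o\<^sub>L z) h = (\<kappa> x o\<^sub>L adj (\<kappa> y) o\<^sub>L \<kappa> z) h"
      by (simp add: \<kappa>_def adj_compose U W Zb that UU WW)
  qed
  have Z': "triple_system Z'"
    unfolding Z'_def by (rule triple_system_hull) (auto intro: \<kappa>_bounded kZ)
  have k_Z': "\<kappa> (k a) \<in> Z'" for a
    unfolding Z'_def by (rule hull_inc) simp
  have \<kappa>_Z': "\<kappa> z \<in> Z'" if "z \<in> Z" for z
  proof (rule triple_extension_induct[OF ext that])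
    show "csubspace {z \<in> Z. \<kappa> z \<in> Z'}"
      using triple_system_csubspace[OF Z] triple_system_csubspace[OF Z']
      by (auto simp: csubspace_iff \<kappa>_add \<kappa>_scaleC) (simp add: \<kappa>_def)
    have "{z \<in> Z. \<kappa> z \<in> Z'} = Z \<inter> \<kappa> -` Z'" by auto
    moreover have "closed (\<kappa> -` Z')"
      unfolding \<kappa>_def by (intro continuous_closed_vimage triple_system_closed[OF Z'])
        (intro continuous_intros)
    ultimately show "closed {z \<in> Z. \<kappa> z \<in> Z'}"
      using triple_system_closed[OF Z] by (simp only: closed_Int)
  qed (auto simp: \<kappa>_triple k_Z' intro: triple_system_triple[OF Z'])
  have "op_mnorm n (\<lambda>p q. \<kappa> (k (x p q))) = op_mnorm n (\<lambda>p q. k (x p q))" for n x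
  proof (rule antisym)
    show "op_mnorm n (\<lambda>p q. \<kappa> (k (x p q))) \<le> op_mnorm n (\<lambda>p q. k (x p q))"
    proof (rule op_mnorm_le[OF op_mnorm_nonneg])
      fix \<eta> :: "nat \<Rightarrow> 'a ell2"
      have "L2_set (\<lambda>p. norm (\<Sum>q<n. \<kappa> (k (x p q)) (\<eta> q))) {..<n}
          = L2_set (\<lambda>p. norm (W (\<Sum>q<n. k (x p q) (adj U (\<eta> q))))) {..<n}"
        by (simp add: \<kappa>_def blinfun.sum_right)
      also have "\<dots> \<le> L2_set (\<lambda>p. norm (\<Sum>q<n. k (x p q) (adj U (\<eta> q)))) {..<n}"
        by (intro L2_set_mono contr W) simp
      also have "\<dots> \<le> op_mnorm n (\<lambda>p q. k (x p q)) * L2_set (\<lambda>q. norm (adj U (\<eta> q))) {..<n}"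
        by (rule op_mnorm_bound)
      also have "\<dots> \<le> op_mnorm n (\<lambda>p q. k (x p q)) * L2_set (\<lambda>q. norm (\<eta> q)) {..<n}"
        by (intro mult_left_mono L2_set_mono contr op_mnorm_nonneg) (simp_all add: U)
      finally show "L2_set (\<lambda>p. norm (\<Sum>q<n. \<kappa> (k (x p q)) (\<eta> q))) {..<n}
          \<le> op_mnorm n (\<lambda>p q. k (x p q)) * L2_set (\<lambda>q. norm (\<eta> q)) {..<n}" .
    qed
  next
    define X where "X = map (\<lambda>p. map (x p) [0..<n]) [0..<n]"
    have X: "X ! p ! q = x p q" if "p < n" "q < n" for p q using that by (simp add: X_def)
    have X_norm: "op_mnorm n (\<lambda>p q. k (X ! p ! q)) = op_mnorm n (\<lambda>p q. k (x p q))"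
      by (rule op_mnorm_cong) (simp add: X)
    show "op_mnorm n (\<lambda>p q. k (x p q)) \<le> op_mnorm n (\<lambda>p q. \<kappa> (k (x p q)))"
    proof (rule field_le_epsilon)
      fix e :: real assume "0 < e"
      then obtain m where m: "inverse (real (Suc m)) < e" using reals_Archimedean by blast
      let ?\<xi> = "\<xi> n X m"
      have "op_mnorm n (\<lambda>p q. k (x p q)) - inverse (real (Suc m))
          < L2_set (\<lambda>p. norm (\<Sum>q<n. k (X ! p ! q) (?\<xi> q))) {..<n}"
        using \<xi>[of n X m] by (simp add: X_norm)
      also have "\<dots> = L2_set (\<lambda>p. norm (\<Sum>q<n. \<kappa> (k (x p q)) (U (?\<xi> q)))) {..<n}"
      proof (rule L2_set_cong[OF refl])
        fix p assume p: "p \<in> {..<n}"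
        have "(\<Sum>q<n. k (x p q) (?\<xi> q)) \<in> Q" by (intro csubspace_sum Q kP \<xi>_P)
        from W_iso[OF this]
        show "norm (\<Sum>q<n. k (X ! p ! q) (?\<xi> q)) = norm (\<Sum>q<n. \<kappa> (k (x p q)) (U (?\<xi> q)))"
          using p by (simp add: X \<kappa>_def UU \<xi>_P blinfun.sum_right)
      qed
      also have "\<dots> \<le> op_mnorm n (\<lambda>p q. \<kappa> (k (x p q)))"
      proof (rule op_mnorm_upper)
        have "L2_set (\<lambda>q. norm (U (?\<xi> q))) {..<n} \<le> L2_set (\<lambda>q. norm (?\<xi> q)) {..<n}"
          by (intro L2_set_mono contr U) simp
        then show "L2_set (\<lambda>q. norm (U (?\<xi> q))) {..<n} \<le> 1" using \<xi>1[of n X m] by simp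
      qed
      finally show "op_mnorm n (\<lambda>p q. k (x p q)) \<le> op_mnorm n (\<lambda>p q. \<kappa> (k (x p q))) + e"
        using m by simp
    qed
  qed
  then have "complete_isometry UNIV N op_mnorm (\<lambda>a. \<kappa> (k a))"
    by (simp add: complete_isometry_def iso)
  moreover have "clinear_on UNIV (\<lambda>a. \<kappa> (k a))"
    using triple_extension_clinear[OF ext] by (simp add: clinear_on_def \<kappa>_add \<kappa>_scaleC)
  moreover have "W' = Z'" if "triple_subspace Z' W'" "range (\<lambda>a. \<kappa> (k a)) \<subseteq> W'" for W'
    using that hull_minimal[OF that(2), of triple_system]
    by (auto simp: triple_subspace_def Z'_def)
  ultimately have "triple_extension N Z' (\<lambda>a. \<kappa> (k a))"
    using Z' k_Z' by (auto simp: triple_extension_def)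
  moreover have "triple_morphism Z Z' \<kappa>"
    using \<kappa>_Z' \<kappa>_triple by (auto simp: triple_morphism_def clinear_on_def \<kappa>_add \<kappa>_scaleC)
  ultimately show thesis using that by blast
qed

lemma triple_morphism_compose:
  assumes "triple_morphism X Y f" "triple_morphism Y Z g"
  shows "triple_morphism X Z (\<lambda>x. g (f x))"
  using assms by (auto simp: triple_morphism_def clinear_on_def image_subset_iff)

text \<open>The required morphism is the compression followed by the morphism that the universal
  property gives on \<open>\<ell>\<^sup>2\<close>.\<close>

theorem triple_envelope_imp_wrt:
  fixes N :: "nat \<Rightarrow> (nat \<Rightarrow> nat \<Rightarrow> 'a::complex_vector) \<Rightarrow> real"
  assumes env: "triple_envelope N T i"
  shows "triple_envelope_wrt TYPE('p::chilbert) TYPE('q::chilbert) N T i"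
proof -
  have T: "triple_extension N T i" using env by (simp add: triple_envelope_wrt_def)
  have "\<exists>\<theta>. triple_morphism Z T \<theta> \<and> (\<forall>a. \<theta> (k a) = i a)"
    if ext: "triple_extension N Z k" for Z :: "('p \<Rightarrow>\<^sub>L 'q) set" and k
  proof (cases "\<forall>a :: 'a. a = 0")
    case False
    then have "infinite (UNIV :: 'a set)" using infinite_UNIV_of_nonzero by blast
    then obtain Z' :: "('a ell2 \<Rightarrow>\<^sub>L 'a ell2) set" and \<kappa>
      where \<kappa>: "triple_morphism Z Z' \<kappa>" and Z': "triple_extension N Z' (\<lambda>a. \<kappa> (k a))"
      by (rule triple_extension_compress[OF _ ext])
    obtain \<theta> where "triple_morphism Z' T \<theta>" "\<forall>a. \<theta> (\<kappa> (k a)) = i a"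
      using env Z' unfolding triple_envelope_wrt_def by blast
    then show ?thesis using triple_morphism_compose[OF \<kappa>] by blast
  next
    \<comment> \<open>The zero space is finite, so the counting argument does not apply to it; the zero map is
      the required morphism.\<close>
    case True
    have "i a = 0" for a
    proof -
      have "i (0 *\<^sub>C a) = 0 *\<^sub>C i a"
        using triple_extension_clinear[OF T] by (auto simp: clinear_on_def simp del: scaleC_zero_left)
      then show ?thesis using True by (metis scaleC_zero_left)
    qed
    moreover have "triple_morphism Z T (\<lambda>_. 0)"
      using csubspace_0[OF triple_system_csubspace[OF triple_extension_system[OF T]]]
      by (auto simp: triple_morphism_def clinear_on_def)
    ultimately show ?thesis by auto
  qed
  then show ?thesis using T by (simp add: triple_envelope_wrt_def)
qed

section \<open>Approximate identities and limits along filters\<close>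

text \<open>The Cauchy criterion along a filter, stated with a single point of comparison because this
  form passes easily to uniform limits.\<close>

lemma convergent_of_nearly_constant:
  fixes f :: "'d \<Rightarrow> 'b::complete_space"
  assumes F: "F \<noteq> bot" and near: "\<And>\<epsilon>. 0 < \<epsilon> \<Longrightarrow> \<exists>c. \<forall>\<^sub>F \<alpha> in F. dist (f \<alpha>) c < \<epsilon>"
  shows "\<exists>l. (f \<longlongrightarrow> l) F"
proof -
  have "cauchy_filter (filtermap f F)"
    unfolding cauchy_filter_metric_filtermap
  proof (intro allI impI)
    fix \<epsilon> :: real assume "0 < \<epsilon>"
    then obtain c where c: "\<forall>\<^sub>F \<alpha> in F. dist (f \<alpha>) c < \<epsilon> / 2" using near[of "\<epsilon> / 2"] by auto
    have "\<forall>\<alpha> \<beta>. dist (f \<alpha>) c < \<epsilon> / 2 \<and> dist (f \<beta>) c < \<epsilon> / 2 \<longrightarrow> dist (f \<alpha>) (f \<beta>) < \<epsilon>"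
      using dist_triangle_half_r[of c _ \<epsilon>] by (auto simp: dist_commute)
    then show "\<exists>P. eventually P F \<and> (\<forall>\<alpha> \<beta>. P \<alpha> \<and> P \<beta> \<longrightarrow> dist (f \<alpha>) (f \<beta>) < \<epsilon>)"
      using c by (intro exI[of _ "\<lambda>\<alpha>. dist (f \<alpha>) c < \<epsilon> / 2"] conjI)
  qed
  then show ?thesis
    using cauchy_filter_complete_converges[of "filtermap f F" UNIV] complete_UNIV F
    by (auto simp: filterlim_def filtermap_bot_iff)
qed

text \<open>With \<open>u = a f\<^sup>* - a\<close> and \<open>f\<close> contractive, \<open>u u\<^sup>* \<le> 2 a a\<^sup>* - a f a\<^sup>* - a f\<^sup>* a\<^sup>*\<close>, and the
  right-hand side is small as soon as \<open>a f\<close> is close to \<open>a\<close>.\<close>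

lemma norm_compose_adj_contraction_le:
  fixes a :: "'g::chilbert \<Rightarrow>\<^sub>L 'h::chilbert" and f :: "'g \<Rightarrow>\<^sub>L 'g"
  assumes a: "a \<in> bounded_ops" and f: "f \<in> bounded_ops" "norm f \<le> 1"
  shows "(norm ((a o\<^sub>L adj f) - a))\<^sup>2 \<le> 2 * norm a * norm (a - (a o\<^sub>L f))"
proof -
  let ?u = "(a o\<^sub>L adj f) - a" and ?M = "2 * norm a * norm (a - (a o\<^sub>L f))"
  have u: "?u \<in> bounded_ops" using a f by simp
  have "norm (adj ?u) \<le> sqrt ?M"
  proof (rule norm_blinfun_bound)
    fix h
    let ?v = "adj a h"
    have "adj ?u h = f ?v - ?v" using a f by (simp add: adj_diff adj_compose blinfun.diff_left)
    then have "(norm (adj ?u h))\<^sup>2 = (norm (f ?v))\<^sup>2 - 2 * inner (f ?v) ?v + (norm ?v)\<^sup>2"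
      by (simp add: power2_norm_eq_inner inner_diff_left inner_diff_right inner_commute)
    also have "\<dots> \<le> 2 * (inner ?v ?v - inner (f ?v) ?v)"
    proof -
      have "norm (f ?v) \<le> norm ?v"
        using order_trans[OF norm_blinfun mult_right_mono[OF f(2) norm_ge_zero]] by simp
      then have "(norm (f ?v))\<^sup>2 \<le> (norm ?v)\<^sup>2" by (intro power_mono) auto
      then show ?thesis by (simp add: power2_norm_eq_inner)
    qed
    also have "\<dots> = 2 * inner ((a - (a o\<^sub>L f)) ?v) h"
      by (simp add: blinfun.diff_left inner_diff_left adj_inner[OF a])
    also have "\<dots> \<le> 2 * (norm ((a - (a o\<^sub>L f)) ?v) * norm h)"
      by (intro mult_left_mono norm_cauchy_schwarz) simp
    also have "\<dots> \<le> 2 * ((norm (a - (a o\<^sub>L f)) * (norm a * norm h)) * norm h)"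
    proof -
      have "norm ?v \<le> norm a * norm h" using norm_blinfun[of "adj a" h] a by simp
      then have "norm (a - (a o\<^sub>L f)) * norm ?v \<le> norm (a - (a o\<^sub>L f)) * (norm a * norm h)"
        by (rule mult_left_mono) simp
      then have "norm ((a - (a o\<^sub>L f)) ?v) \<le> norm (a - (a o\<^sub>L f)) * (norm a * norm h)"
        using norm_blinfun[of "a - (a o\<^sub>L f)" ?v] by linarith
      then have "norm ((a - (a o\<^sub>L f)) ?v) * norm h
          \<le> (norm (a - (a o\<^sub>L f)) * (norm a * norm h)) * norm h" by (rule mult_right_mono) simp
      then show ?thesis by linarith
    qed
    also have "\<dots> = (sqrt ?M * norm h)\<^sup>2"
      by (simp add: power_mult_distrib) (simp add: power2_eq_square mult_ac)
    finally show "norm (adj ?u h) \<le> sqrt ?M * norm h" by (rule power2_le_imp_le) simp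
  qed simp
  then have "(norm (adj ?u))\<^sup>2 \<le> (sqrt ?M)\<^sup>2" by (intro power_mono) auto
  then show ?thesis using u by simp
qed

lemma tendsto_compose_adj_contraction:
  fixes a :: "'g::chilbert \<Rightarrow>\<^sub>L 'h::chilbert" and f :: "'d \<Rightarrow> ('g \<Rightarrow>\<^sub>L 'g)"
  assumes a: "a \<in> bounded_ops" and f: "\<And>\<alpha>. f \<alpha> \<in> bounded_ops" "\<And>\<alpha>. norm (f \<alpha>) \<le> 1"
    and lim: "((\<lambda>\<alpha>. a o\<^sub>L f \<alpha>) \<longlongrightarrow> a) F"
  shows "((\<lambda>\<alpha>. a o\<^sub>L adj (f \<alpha>)) \<longlongrightarrow> a) F"
proof -
  have "((\<lambda>\<alpha>. 2 * norm a * norm (a - (a o\<^sub>L f \<alpha>))) \<longlongrightarrow> 2 * norm a * 0) F"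
    using LIM_zero[OF lim]
    by (intro tendsto_mult tendsto_const) (subst norm_minus_commute, rule tendsto_norm_zero)
  then have lim0: "((\<lambda>\<alpha>. 2 * norm a * norm (a - (a o\<^sub>L f \<alpha>))) \<longlongrightarrow> 0) F" by simp
  have "((\<lambda>\<alpha>. (norm ((a o\<^sub>L adj (f \<alpha>)) - a))\<^sup>2) \<longlongrightarrow> 0) F"
  proof (rule Lim_null_comparison[OF _ lim0])
    show "\<forall>\<^sub>F \<alpha> in F. norm ((norm ((a o\<^sub>L adj (f \<alpha>)) - a))\<^sup>2) \<le> 2 * norm a * norm (a - (a o\<^sub>L f \<alpha>))"
      using norm_compose_adj_contraction_le[OF a f] by (intro always_eventually allI) simp
  qed
  then have "((\<lambda>\<alpha>. sqrt ((norm ((a o\<^sub>L adj (f \<alpha>)) - a))\<^sup>2)) \<longlongrightarrow> sqrt 0) F" by (rule tendsto_real_sqrt)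
  then show ?thesis by (simp add: tendsto_norm_zero_iff LIM_zero_iff)
qed

lemma closed_approximated:
  fixes A :: "'d \<Rightarrow> ('k::chilbert \<Rightarrow>\<^sub>L 'k)"
  assumes A: "\<And>\<alpha>. norm (A \<alpha>) \<le> 1"
  shows "closed {x :: 'k \<Rightarrow>\<^sub>L 'h::chilbert. ((\<lambda>\<alpha>. x o\<^sub>L A \<alpha>) \<longlongrightarrow> x) F}"
  unfolding closed_sequential_limits
proof (intro allI impI, elim conjE)
  fix f and l :: "'k \<Rightarrow>\<^sub>L 'h"
  assume f: "\<forall>n. f n \<in> {x. ((\<lambda>\<alpha>. x o\<^sub>L A \<alpha>) \<longlongrightarrow> x) F}" and lim: "f \<longlonglongrightarrow> l"
  have "\<forall>\<^sub>F \<alpha> in F. dist (l o\<^sub>L A \<alpha>) l < \<epsilon>" if "0 < \<epsilon>" for \<epsilon>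
  proof -
    have "0 < \<epsilon> / 3" using that by simp
    then obtain n where n: "dist (f n) l < \<epsilon> / 3"
      using lim unfolding lim_sequentially by blast
    have "\<forall>\<^sub>F \<alpha> in F. dist (f n o\<^sub>L A \<alpha>) (f n) < \<epsilon> / 3"
      using f by (intro tendstoD[OF _ \<open>0 < \<epsilon> / 3\<close>]) blast
    then show ?thesis
    proof eventually_elim
      case (elim \<alpha>)
      have "norm ((f n - l) o\<^sub>L A \<alpha>) \<le> norm (f n - l)"
        using order_trans[OF norm_blinfun_compose mult_left_mono[OF A norm_ge_zero]] by simp
      then have "dist (l o\<^sub>L A \<alpha>) (f n o\<^sub>L A \<alpha>) \<le> dist (f n) l"
        by (simp add: dist_norm compose_diff_left norm_minus_commute)
      then show ?case
        using dist_triangle[of "l o\<^sub>L A \<alpha>" l "f n o\<^sub>L A \<alpha>"] dist_triangle[of "f n o\<^sub>L A \<alpha>" l "f n"]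
          elim n by linarith
    qed
  qed
  then show "l \<in> {x. ((\<lambda>\<alpha>. x o\<^sub>L A \<alpha>) \<longlongrightarrow> x) F}" by (simp add: tendsto_iff)
qed

lemma csubspace_approximated:
  fixes A :: "'d \<Rightarrow> ('k::chilbert \<Rightarrow>\<^sub>L 'k)"
  shows "csubspace {x :: 'k \<Rightarrow>\<^sub>L 'h::chilbert. ((\<lambda>\<alpha>. x o\<^sub>L A \<alpha>) \<longlongrightarrow> x) F}"
  by (auto simp: csubspace_iff compose_add_left compose_scaleC_left intro!: tendsto_add
      bounded_linear.tendsto[OF bounded_linear_scaleC_blinfun])

lemma csubspace_inter: "csubspace A \<Longrightarrow> csubspace B \<Longrightarrow> csubspace (A \<inter> B)"
  by (simp add: csubspace_iff)

lemma op_prod_adj: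
  "op_prod X (adj ` X) = closure {\<Sum>m<n. x m o\<^sub>L adj (y m) | (n::nat) x y. \<forall>m<n. x m \<in> X \<and> y m \<in> X}"
proof -
  have "{\<Sum>m<n. x m o\<^sub>L y m | (n::nat) x y. \<forall>m<n. x m \<in> X \<and> y m \<in> adj ` X}
      = {\<Sum>m<n. x m o\<^sub>L adj (y m) | (n::nat) x y. \<forall>m<n. x m \<in> X \<and> y m \<in> X}" (is "?L = ?R")
  proof
    show "?L \<subseteq> ?R"
    proof clarify
      fix n :: nat and x y
      assume "\<forall>m<n. x m \<in> X \<and> y m \<in> adj ` X"
      then have "\<forall>m. \<exists>w. m < n \<longrightarrow> x m \<in> X \<and> w \<in> X \<and> y m = adj w" by blast
      then obtain y' where "\<And>m. m < n \<Longrightarrow> x m \<in> X \<and> y' m \<in> X \<and> y m = adj (y' m)" by metis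
      then show "\<exists>(n' :: nat) x' y'. (\<Sum>m<n. x m o\<^sub>L y m) = (\<Sum>m<n'. x' m o\<^sub>L adj (y' m)) \<and>
          (\<forall>m<n'. x' m \<in> X \<and> y' m \<in> X)"
        by - (rule exI[of _ n], rule exI[of _ x], rule exI[of _ y'], simp cong: sum.cong_simp)
    qed
    show "?R \<subseteq> ?L"
    proof clarify
      fix n :: nat and x y
      assume "\<forall>m<n. x m \<in> X \<and> y m \<in> X"
      then show "\<exists>(n' :: nat) x' y'. (\<Sum>m<n. x m o\<^sub>L adj (y m)) = (\<Sum>m<n'. x' m o\<^sub>L y' m) \<and>
          (\<forall>m<n'. x' m \<in> X \<and> y' m \<in> adj ` X)"
        by (intro exI[of _ n] exI[of _ x] exI[of _ "\<lambda>m. adj (y m)"]) simp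
    qed
  qed
  then show ?thesis by (simp only: op_prod_def)
qed

section \<open>The left ideal attached to a right contractive approximate identity\<close>

text \<open>The setting: \<open>\<rho>\<close> represents the algebra on a Hilbert space, \<open>Z\<close> is the triple system that it
  generates there, and \<open>\<theta>\<close> comes from the universal property of the triple envelope \<open>T\<close>. Products
  in the algebra are visible in \<open>Z\<close>, and \<open>\<theta>\<close> carries what they say about the approximate identity
  to \<open>T\<close>.\<close>

locale represented_triple_extension =
  fixes N :: "nat \<Rightarrow> (nat \<Rightarrow> nat \<Rightarrow> 'a::complex_algebra) \<Rightarrow> real"
    and Z :: "('g::chilbert \<Rightarrow>\<^sub>L 'g) set" and \<rho> :: "'a \<Rightarrow> ('g \<Rightarrow>\<^sub>L 'g)"
    and T :: "('k::chilbert \<Rightarrow>\<^sub>L 'h::chilbert) set" and i :: "'a \<Rightarrow> ('k \<Rightarrow>\<^sub>L 'h)"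
    and \<theta> :: "('g \<Rightarrow>\<^sub>L 'g) \<Rightarrow> ('k \<Rightarrow>\<^sub>L 'h)"
    and e :: "'d \<Rightarrow> 'a" and F :: "'d filter"
  assumes Z_ext: "triple_extension N Z \<rho>" and T_ext: "triple_extension N T i"
    and mult: "\<And>a b. \<rho> (a * b) = \<rho> a o\<^sub>L \<rho> b"
    and \<theta>: "triple_morphism Z T \<theta>" and \<theta>_\<rho>: "\<And>a. \<theta> (\<rho> a) = i a"
    and cai: "right_cai (*) (\<lambda>a. N 1 (\<lambda>_ _. a)) UNIV e F"
begin

definition \<psi> :: "('k \<Rightarrow>\<^sub>L 'h) \<Rightarrow> ('h \<Rightarrow>\<^sub>L 'h)" where
  "\<psi> x = Lim F (\<lambda>\<alpha>. x o\<^sub>L adj (i (e \<alpha>)))"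

lemmas Z_sys = triple_extension_system[OF Z_ext] and T_sys = triple_extension_system[OF T_ext]
lemmas \<rho>_Z = triple_extension_in[OF Z_ext] and i_T = triple_extension_in[OF T_ext]
lemmas Z_bounded = triple_system_bounded_ops[OF Z_sys]
  and T_bounded = triple_system_bounded_ops[OF T_sys]
lemmas Z_triple = triple_system_triple[OF Z_sys] and T_triple = triple_system_triple[OF T_sys]
lemmas T_csubspace = triple_system_csubspace[OF T_sys] and T_closed = triple_system_closed[OF T_sys]

lemma F_proper: "F \<noteq> bot"
  using cai by (simp add: right_cai_def)

lemma \<rho>_bounded [simp]: "\<rho> a \<in> bounded_ops" and i_bounded [simp]: "i a \<in> bounded_ops"
  using Z_bounded \<rho>_Z T_bounded i_T by blast+

lemma norm_i_e: "norm (i (e \<alpha>)) \<le> 1" and norm_\<rho>_e: "norm (\<rho> (e \<alpha>)) \<le> 1"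
  using cai by (simp_all add: triple_extension_norm[OF T_ext] triple_extension_norm[OF Z_ext] right_cai_def)

lemma \<theta>_contractive: "z \<in> Z \<Longrightarrow> norm (\<theta> z) \<le> norm z"
  by (rule triple_morphism_contractive[OF Z_sys T_sys \<theta>])

lemma \<theta>_diff: "x \<in> Z \<Longrightarrow> y \<in> Z \<Longrightarrow> \<theta> (x - y) = \<theta> x - \<theta> y"
  using \<theta> triple_system_csubspace[OF Z_sys] by (auto simp: triple_morphism_def intro!: clinear_on_diff)

lemma \<theta>_tendsto:
  assumes f: "(f \<longlongrightarrow> l) G" and Z: "\<And>\<alpha>. f \<alpha> \<in> Z" "l \<in> Z"
  shows "((\<lambda>\<alpha>. \<theta> (f \<alpha>)) \<longlongrightarrow> \<theta> l) G"
proof -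
  have "((\<lambda>\<alpha>. \<theta> (f \<alpha>) - \<theta> l) \<longlongrightarrow> 0) G"
  proof (rule Lim_null_comparison)
    show "\<forall>\<^sub>F \<alpha> in G. norm (\<theta> (f \<alpha>) - \<theta> l) \<le> norm (f \<alpha> - l)"
      using csubspace_diff[OF triple_system_csubspace[OF Z_sys]]
      by (intro always_eventually allI) (simp add: \<theta>_diff[symmetric] \<theta>_contractive Z)
    show "((\<lambda>\<alpha>. norm (f \<alpha> - l)) \<longlongrightarrow> 0) G" using f by (simp add: LIM_zero tendsto_norm_zero)
  qed
  then show ?thesis by (rule LIM_zero_cancel)
qed

lemma \<rho>_right_cai:
  assumes "right_cai (*) (\<lambda>a. N 1 (\<lambda>_ _. a)) UNIV e' F'"
  shows "((\<lambda>\<alpha>. \<rho> a o\<^sub>L \<rho> (e' \<alpha>)) \<longlongrightarrow> \<rho> a) F'"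
proof -
  have "csubspace (UNIV :: 'a set)" by (simp add: csubspace_iff)
  then have "norm ((\<rho> a o\<^sub>L \<rho> (e' \<alpha>)) - \<rho> a) = N 1 (\<lambda>_ _. a * e' \<alpha> - a)" for \<alpha>
    using triple_extension_norm[OF Z_ext, of "a * e' \<alpha> - a"]
    by (simp add: mult clinear_on_diff[OF triple_extension_clinear[OF Z_ext]])
  then have "((\<lambda>\<alpha>. norm ((\<rho> a o\<^sub>L \<rho> (e' \<alpha>)) - \<rho> a)) \<longlongrightarrow> 0) F'"
    using assms by (simp add: right_cai_def)
  then show ?thesis by (simp add: tendsto_norm_zero_iff LIM_zero_iff)
qed

lemma \<rho>_e_adj: "((\<lambda>\<alpha>. \<rho> a o\<^sub>L adj (\<rho> (e \<alpha>))) \<longlongrightarrow> \<rho> a) F"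
  by (rule tendsto_compose_adj_contraction[OF _ _ norm_\<rho>_e \<rho>_right_cai[OF cai]]) simp_all

lemma \<rho>_e_adj_e: "((\<lambda>\<alpha>. \<rho> a o\<^sub>L adj (\<rho> (e \<alpha>)) o\<^sub>L \<rho> (e \<alpha>)) \<longlongrightarrow> \<rho> a) F"
proof -
  let ?u = "\<lambda>\<alpha>. (\<rho> a o\<^sub>L adj (\<rho> (e \<alpha>))) - \<rho> a"
  have "((\<lambda>\<alpha>. ?u \<alpha> o\<^sub>L \<rho> (e \<alpha>)) \<longlongrightarrow> 0) F"
  proof (rule Lim_null_comparison)
    show "\<forall>\<^sub>F \<alpha> in F. norm (?u \<alpha> o\<^sub>L \<rho> (e \<alpha>)) \<le> norm (?u \<alpha>)"
      using order_trans[OF norm_blinfun_compose mult_left_mono[OF norm_\<rho>_e norm_ge_zero]]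
      by (intro always_eventually allI) simp
    show "((\<lambda>\<alpha>. norm (?u \<alpha>)) \<longlongrightarrow> 0) F" using \<rho>_e_adj by (simp add: LIM_zero tendsto_norm_zero)
  qed
  from tendsto_add[OF this \<rho>_right_cai[OF cai, of a]] show ?thesis by (simp add: compose_diff_left)
qed

text \<open>As \<open>x i(e\<^sub>\<alpha>)\<^sup>*\<close> maps between other spaces than the elements of \<open>T\<close>, its limit cannot be
  obtained by applying \<open>\<theta>\<close> to a limit in \<open>Z\<close>. On the generators \<open>i a\<close> the Cauchy property is
  inherited from \<open>\<rho>(a) \<rho>(e\<^sub>\<alpha>)\<^sup>*\<close>, by the contractivity of \<open>x y\<^sup>* \<mapsto> \<theta>(x) \<theta>(y)\<^sup>*\<close>.\<close>

lemma convergent_compose_adj_i_e: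
  assumes "x \<in> T" shows "\<exists>l. ((\<lambda>\<alpha>. x o\<^sub>L adj (i (e \<alpha>))) \<longlongrightarrow> l) F"
proof (rule triple_extension_induct[OF T_ext assms])
  fix a
  show "\<exists>l. ((\<lambda>\<alpha>. i a o\<^sub>L adj (i (e \<alpha>))) \<longlongrightarrow> l) F"
  proof (rule convergent_of_nearly_constant[OF F_proper])
    fix \<epsilon> :: real assume \<epsilon>: "0 < \<epsilon>"
    then have ev: "\<forall>\<^sub>F \<alpha> in F. dist (\<rho> a o\<^sub>L adj (\<rho> (e \<alpha>))) (\<rho> a) < \<epsilon> / 2"
      by (intro tendstoD[OF \<rho>_e_adj]) simp
    then obtain \<beta> where \<beta>: "dist (\<rho> a o\<^sub>L adj (\<rho> (e \<beta>))) (\<rho> a) < \<epsilon> / 2"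
      using eventually_happens'[OF F_proper] by blast
    have "\<forall>\<^sub>F \<alpha> in F. dist (i a o\<^sub>L adj (i (e \<alpha>))) (i a o\<^sub>L adj (i (e \<beta>))) < \<epsilon>"
      using ev
    proof eventually_elim
      case (elim \<alpha>)
      have d: "\<rho> (e \<alpha>) - \<rho> (e \<beta>) \<in> Z"
        by (intro csubspace_diff[OF triple_system_csubspace[OF Z_sys]] \<rho>_Z)
      have "dist (i a o\<^sub>L adj (i (e \<alpha>))) (i a o\<^sub>L adj (i (e \<beta>)))
          = norm (\<theta> (\<rho> a) o\<^sub>L adj (\<theta> (\<rho> (e \<alpha>) - \<rho> (e \<beta>))))"
        by (simp add: \<theta>_diff \<rho>_Z \<theta>_\<rho> adj_diff dist_norm compose_diff_right)
      also have "\<dots> \<le> norm (\<rho> a o\<^sub>L adj (\<rho> (e \<alpha>) - \<rho> (e \<beta>)))"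
        by (rule triple_morphism_norm_compose_adj[OF Z_sys T_sys \<theta> \<rho>_Z d])
      also have "\<dots> = dist (\<rho> a o\<^sub>L adj (\<rho> (e \<alpha>))) (\<rho> a o\<^sub>L adj (\<rho> (e \<beta>)))"
        by (simp add: adj_diff dist_norm compose_diff_right)
      also have "\<dots> < \<epsilon>" using elim \<beta> by (rule dist_triangle_half_l)
      finally show ?case .
    qed
    then show "\<exists>c. \<forall>\<^sub>F \<alpha> in F. dist (i a o\<^sub>L adj (i (e \<alpha>))) c < \<epsilon>" by blast
  qed
next
  show "csubspace {x \<in> T. \<exists>l. ((\<lambda>\<alpha>. x o\<^sub>L adj (i (e \<alpha>))) \<longlongrightarrow> l) F}"
    unfolding csubspace_iff mem_Collect_eq
  proof (intro conjI ballI allI)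
    show "0 \<in> T" by (rule csubspace_0[OF T_csubspace])
    show "\<exists>l. ((\<lambda>\<alpha>. 0 o\<^sub>L adj (i (e \<alpha>))) \<longlongrightarrow> l) F" by (intro exI[of _ 0]) simp
  next
    fix x y
    assume x: "x \<in> {x \<in> T. \<exists>l. ((\<lambda>\<alpha>. x o\<^sub>L adj (i (e \<alpha>))) \<longlongrightarrow> l) F}"
      and y: "y \<in> {x \<in> T. \<exists>l. ((\<lambda>\<alpha>. x o\<^sub>L adj (i (e \<alpha>))) \<longlongrightarrow> l) F}"
    then show "x + y \<in> T" by (simp add: csubspace_add[OF T_csubspace])
    show "\<exists>l. ((\<lambda>\<alpha>. (x + y) o\<^sub>L adj (i (e \<alpha>))) \<longlongrightarrow> l) F"
      unfolding compose_add_left using x y tendsto_add by blast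
  next
    fix c x
    assume x: "x \<in> {x \<in> T. \<exists>l. ((\<lambda>\<alpha>. x o\<^sub>L adj (i (e \<alpha>))) \<longlongrightarrow> l) F}"
    then show "c *\<^sub>C x \<in> T" by (simp add: csubspace_scaleC[OF T_csubspace])
    show "\<exists>l. ((\<lambda>\<alpha>. (c *\<^sub>C x) o\<^sub>L adj (i (e \<alpha>))) \<longlongrightarrow> l) F"
      unfolding compose_scaleC_left
      using x bounded_linear.tendsto[OF bounded_linear_scaleC_blinfun] by blast
  qed
next
  show "closed {x \<in> T. \<exists>l. ((\<lambda>\<alpha>. x o\<^sub>L adj (i (e \<alpha>))) \<longlongrightarrow> l) F}"
    unfolding closed_sequential_limits
  proof (intro allI impI, elim conjE)
    fix f x
    assume f: "\<forall>n. f n \<in> {x \<in> T. \<exists>l. ((\<lambda>\<alpha>. x o\<^sub>L adj (i (e \<alpha>))) \<longlongrightarrow> l) F}" and lim: "f \<longlonglongrightarrow> x"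
    have "x \<in> T" by (rule closed_sequentially[OF T_closed _ lim]) (use f in blast)
    moreover have "\<exists>l. ((\<lambda>\<alpha>. x o\<^sub>L adj (i (e \<alpha>))) \<longlongrightarrow> l) F"
    proof (rule convergent_of_nearly_constant[OF F_proper])
      fix \<epsilon> :: real assume "0 < \<epsilon>"
      then have \<epsilon>: "0 < \<epsilon> / 2" by simp
      then obtain n where n: "dist (f n) x < \<epsilon> / 2"
        using lim unfolding lim_sequentially by blast
      obtain l where "((\<lambda>\<alpha>. f n o\<^sub>L adj (i (e \<alpha>))) \<longlongrightarrow> l) F" using f by blast
      from tendstoD[OF this \<epsilon>]
      have "\<forall>\<^sub>F \<alpha> in F. dist (x o\<^sub>L adj (i (e \<alpha>))) l < \<epsilon>"
      proof eventually_elim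
        case (elim \<alpha>)
        have "norm ((f n - x) o\<^sub>L adj (i (e \<alpha>))) \<le> norm (f n - x) * 1"
          by (rule order_trans[OF norm_blinfun_compose]) (intro mult_left_mono, simp_all add: norm_i_e)
        then have "dist (f n o\<^sub>L adj (i (e \<alpha>))) (x o\<^sub>L adj (i (e \<alpha>))) < \<epsilon> / 2"
          using n by (simp add: dist_norm compose_diff_left)
        then show ?case using elim by (rule dist_triangle_half_r)
      qed
      then show "\<exists>c. \<forall>\<^sub>F \<alpha> in F. dist (x o\<^sub>L adj (i (e \<alpha>))) c < \<epsilon>" by blast
    qed
    ultimately show "x \<in> {x \<in> T. \<exists>l. ((\<lambda>\<alpha>. x o\<^sub>L adj (i (e \<alpha>))) \<longlongrightarrow> l) F}" by blast
  qed
next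
  fix x y z :: "'k \<Rightarrow>\<^sub>L 'h"
  assume "\<exists>l. ((\<lambda>\<alpha>. z o\<^sub>L adj (i (e \<alpha>))) \<longlongrightarrow> l) F"
  then obtain l where "((\<lambda>\<alpha>. z o\<^sub>L adj (i (e \<alpha>))) \<longlongrightarrow> l) F" ..
  from tendsto_compose_op[OF tendsto_const[of "x o\<^sub>L adj y"] this]
  show "\<exists>l. ((\<lambda>\<alpha>. x o\<^sub>L adj y o\<^sub>L z o\<^sub>L adj (i (e \<alpha>))) \<longlongrightarrow> l) F"
    by (intro exI) (simp only: compose_assoc)
qed

lemma \<psi>_tendsto: "x \<in> T \<Longrightarrow> ((\<lambda>\<alpha>. x o\<^sub>L adj (i (e \<alpha>))) \<longlongrightarrow> \<psi> x) F"
  using convergent_compose_adj_i_e[of x] tendsto_Lim[OF F_proper] unfolding \<psi>_def by metis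

lemma \<psi>_eqI: "x \<in> T \<Longrightarrow> ((\<lambda>\<alpha>. x o\<^sub>L adj (i (e \<alpha>))) \<longlongrightarrow> l) F \<Longrightarrow> \<psi> x = l"
  by (rule tendsto_unique[OF F_proper \<psi>_tendsto])

lemma approximated_by_adj_i_e_i_e:
  assumes "x \<in> T" shows "((\<lambda>\<alpha>. x o\<^sub>L (adj (i (e \<alpha>)) o\<^sub>L i (e \<alpha>))) \<longlongrightarrow> x) F"
proof (rule triple_extension_induct[OF T_ext assms])
  fix a
  have "((\<lambda>\<alpha>. \<theta> (\<rho> a o\<^sub>L adj (\<rho> (e \<alpha>)) o\<^sub>L \<rho> (e \<alpha>))) \<longlongrightarrow> \<theta> (\<rho> a)) F"
    by (rule \<theta>_tendsto[OF \<rho>_e_adj_e]) (simp_all add: Z_triple \<rho>_Z)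
  then show "((\<lambda>\<alpha>. i a o\<^sub>L (adj (i (e \<alpha>)) o\<^sub>L i (e \<alpha>))) \<longlongrightarrow> i a) F"
    unfolding triple_morphism_triple[OF \<theta> \<rho>_Z \<rho>_Z \<rho>_Z] \<theta>_\<rho> by (simp only: compose_assoc)
next
  have n: "norm (adj (i (e \<alpha>)) o\<^sub>L i (e \<alpha>)) \<le> 1" for \<alpha>
    using mult_mono[OF norm_i_e norm_i_e] norm_blinfun_compose[of "adj (i (e \<alpha>))" "i (e \<alpha>)"]
    by (simp, meson norm_ge_zero order_trans mult_le_one norm_i_e)
  have eq: "{x \<in> T. ((\<lambda>\<alpha>. x o\<^sub>L (adj (i (e \<alpha>)) o\<^sub>L i (e \<alpha>))) \<longlongrightarrow> x) F}
      = T \<inter> {x. ((\<lambda>\<alpha>. x o\<^sub>L (adj (i (e \<alpha>)) o\<^sub>L i (e \<alpha>))) \<longlongrightarrow> x) F}" by blast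
  show "csubspace {x \<in> T. ((\<lambda>\<alpha>. x o\<^sub>L (adj (i (e \<alpha>)) o\<^sub>L i (e \<alpha>))) \<longlongrightarrow> x) F}"
    unfolding eq by (rule csubspace_inter[OF T_csubspace csubspace_approximated])
  show "closed {x \<in> T. ((\<lambda>\<alpha>. x o\<^sub>L (adj (i (e \<alpha>)) o\<^sub>L i (e \<alpha>))) \<longlongrightarrow> x) F}"
    unfolding eq by (rule closed_Int[OF T_closed closed_approximated[OF n]])
next
  fix x y z :: "'k \<Rightarrow>\<^sub>L 'h"
  assume "((\<lambda>\<alpha>. z o\<^sub>L (adj (i (e \<alpha>)) o\<^sub>L i (e \<alpha>))) \<longlongrightarrow> z) F"
  then show "((\<lambda>\<alpha>. x o\<^sub>L adj y o\<^sub>L z o\<^sub>L (adj (i (e \<alpha>)) o\<^sub>L i (e \<alpha>))) \<longlongrightarrow> x o\<^sub>L adj y o\<^sub>L z) F"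
    using tendsto_compose_op[OF tendsto_const[of "x o\<^sub>L adj y"]] by (simp add: compose_assoc)
qed

lemma \<psi>_bounded [simp]: "x \<in> T \<Longrightarrow> \<psi> x \<in> bounded_ops"
  by (rule Lim_in_closed_set[OF closed_bounded_ops _ F_proper \<psi>_tendsto]) (simp_all add: T_bounded)

lemma \<psi>_clinear: "clinear_on T \<psi>"
  unfolding clinear_on_def
proof (intro conjI ballI allI)
  fix x y assume "x \<in> T" "y \<in> T"
  then show "\<psi> (x + y) = \<psi> x + \<psi> y"
    by (intro \<psi>_eqI csubspace_add[OF T_csubspace]) (auto simp: compose_add_left intro!: tendsto_add \<psi>_tendsto)
next
  fix c x assume "x \<in> T"
  then show "\<psi> (c *\<^sub>C x) = c *\<^sub>C \<psi> x"
    by (intro \<psi>_eqI csubspace_scaleC[OF T_csubspace])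
      (auto simp: compose_scaleC_left intro!: bounded_linear.tendsto[OF bounded_linear_scaleC_blinfun] \<psi>_tendsto)
qed

lemma \<psi>_left_module:
  "x \<in> T \<Longrightarrow> y \<in> T \<Longrightarrow> z \<in> T \<Longrightarrow> \<psi> (x o\<^sub>L adj y o\<^sub>L z) = x o\<^sub>L adj y o\<^sub>L \<psi> z"
  by (rule \<psi>_eqI[OF T_triple])
    (auto simp: compose_assoc intro!: tendsto_compose_op[OF tendsto_const] \<psi>_tendsto)

text \<open>The product \<open>(x i(e\<^sub>\<alpha>)\<^sup>*) (y i(e\<^sub>\<alpha>)\<^sup>*)\<^sup>* = (x i(e\<^sub>\<alpha>)\<^sup>* i(e\<^sub>\<alpha>)) y\<^sup>*\<close> has two descriptions of its limit.\<close>

lemma \<psi>_compose_adj: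
  assumes x: "x \<in> T" and y: "y \<in> T"
  shows "\<psi> x o\<^sub>L adj (\<psi> y) = x o\<^sub>L adj y"
proof (rule tendsto_unique[OF F_proper])
  have "((\<lambda>\<alpha>. adj (y o\<^sub>L adj (i (e \<alpha>)))) \<longlongrightarrow> adj (\<psi> y)) F"
    by (rule adj_tendsto[OF \<psi>_tendsto[OF y]]) (simp_all add: y T_bounded)
  from tendsto_compose_op[OF \<psi>_tendsto[OF x] this]
  show "((\<lambda>\<alpha>. x o\<^sub>L (adj (i (e \<alpha>)) o\<^sub>L i (e \<alpha>)) o\<^sub>L adj y) \<longlongrightarrow> \<psi> x o\<^sub>L adj (\<psi> y)) F"
    by (simp add: adj_compose y T_bounded compose_assoc)
  show "((\<lambda>\<alpha>. x o\<^sub>L (adj (i (e \<alpha>)) o\<^sub>L i (e \<alpha>)) o\<^sub>L adj y) \<longlongrightarrow> x o\<^sub>L adj y) F"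
    by (intro tendsto_compose_op tendsto_const approximated_by_adj_i_e_i_e x)
qed

lemma \<psi>_complete_isometry: "complete_isometry T op_mnorm op_mnorm \<psi>"
  unfolding complete_isometry_def
proof (intro allI impI)
  fix n and x :: "nat \<Rightarrow> nat \<Rightarrow> ('k \<Rightarrow>\<^sub>L 'h)"
  assume "\<forall>p<n. \<forall>q<n. x p q \<in> T"
  then show "op_mnorm n (\<lambda>p q. \<psi> (x p q)) = op_mnorm n x"
    by (intro antisym op_mnorm_le_of_gram) (simp_all add: T_bounded \<psi>_compose_adj)
qed

lemma norm_\<psi>: assumes "x \<in> T" shows "norm (\<psi> x) = norm x"
proof -
  have "(norm (\<psi> x))\<^sup>2 = (norm x)\<^sup>2"
    using assms by (simp add: norm_compose_adj[symmetric] \<psi>_compose_adj T_bounded)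
  then show ?thesis by (simp add: power2_eq_iff_nonneg)
qed

lemma \<psi>_diff: "x \<in> T \<Longrightarrow> y \<in> T \<Longrightarrow> \<psi> (x - y) = \<psi> x - \<psi> y"
  by (rule clinear_on_diff[OF \<psi>_clinear T_csubspace])

lemma dist_\<psi>: "x \<in> T \<Longrightarrow> y \<in> T \<Longrightarrow> dist (\<psi> x) (\<psi> y) = dist x y"
  by (simp add: dist_norm \<psi>_diff[symmetric] norm_\<psi> csubspace_diff[OF T_csubspace])

lemma \<psi>_continuous_on: "continuous_on T \<psi>"
  unfolding continuous_on_iff using dist_\<psi> by metis

lemma \<psi>_in_left_cstar: assumes "x \<in> T" shows "\<psi> x \<in> left_cstar T"
proof (rule Lim_in_closed_set[OF _ _ F_proper \<psi>_tendsto[OF assms]])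
  show "closed (left_cstar T)" by (simp add: left_cstar_def op_prod_def)
  have "x o\<^sub>L adj (i a) \<in> {\<Sum>m<n. x m o\<^sub>L adj (y m) | (n::nat) x y. \<forall>m<n. x m \<in> T \<and> y m \<in> T}" for a
    unfolding mem_Collect_eq
    by (intro exI[of _ 1] exI[of _ "\<lambda>_. x"] exI[of _ "\<lambda>_. i a"]) (simp add: assms i_T)
  then show "\<forall>\<^sub>F \<alpha> in F. x o\<^sub>L adj (i (e \<alpha>)) \<in> left_cstar T"
    unfolding left_cstar_def op_prod_adj
    by (intro always_eventually allI) (rule subsetD[OF closure_subset])
qed

text \<open>The multiplication of the algebra reaches \<open>T\<close> through
  \<open>i(a) i(e\<^sub>\<alpha>)\<^sup>* i(b) = \<theta>(\<rho>(a) \<rho>(e\<^sub>\<alpha>)\<^sup>* \<rho>(b))\<close>, where the argument of \<open>\<theta>\<close> tends to \<open>\<rho>(a b)\<close>.\<close>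

lemma \<psi>_i_compose_i: "\<psi> (i a) o\<^sub>L i b = i (a * b)"
proof (rule tendsto_unique[OF F_proper])
  show "((\<lambda>\<alpha>. i a o\<^sub>L adj (i (e \<alpha>)) o\<^sub>L i b) \<longlongrightarrow> \<psi> (i a) o\<^sub>L i b) F"
    by (intro tendsto_compose_op tendsto_const \<psi>_tendsto i_T)
  have "((\<lambda>\<alpha>. \<theta> (\<rho> a o\<^sub>L adj (\<rho> (e \<alpha>)) o\<^sub>L \<rho> b)) \<longlongrightarrow> \<theta> (\<rho> (a * b))) F"
    by (rule \<theta>_tendsto)
      (auto simp: mult[symmetric] \<rho>_Z intro!: Z_triple \<rho>_Z, auto simp: mult intro!: tendsto_compose_op \<rho>_e_adj)
  then show "((\<lambda>\<alpha>. i a o\<^sub>L adj (i (e \<alpha>)) o\<^sub>L i b) \<longlongrightarrow> i (a * b)) F"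
    by (simp add: triple_morphism_triple[OF \<theta>] \<rho>_Z \<theta>_\<rho>)
qed

lemma \<psi>_i_mult: "\<psi> (i (a * b)) = \<psi> (i a) o\<^sub>L \<psi> (i b)"
proof (rule \<psi>_eqI[OF i_T])
  have "((\<lambda>\<alpha>. \<psi> (i a) o\<^sub>L (i b o\<^sub>L adj (i (e \<alpha>)))) \<longlongrightarrow> \<psi> (i a) o\<^sub>L \<psi> (i b)) F"
    by (intro tendsto_compose_op tendsto_const \<psi>_tendsto i_T)
  then show "((\<lambda>\<alpha>. i (a * b) o\<^sub>L adj (i (e \<alpha>))) \<longlongrightarrow> \<psi> (i a) o\<^sub>L \<psi> (i b)) F"
    by (simp add: compose_assoc[symmetric] \<psi>_i_compose_i)
qed

lemma \<psi>_triple_morphism: "triple_morphism T (\<psi> ` T) \<psi>"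
  using \<psi>_clinear by (auto simp: triple_morphism_def \<psi>_left_module \<psi>_compose_adj)

lemma csubspace_range_\<psi>: "csubspace (\<psi> ` T)"
  unfolding csubspace_iff
proof (intro conjI ballI allI)
  have "\<psi> 0 = 0" using \<psi>_diff[OF csubspace_0[OF T_csubspace] csubspace_0[OF T_csubspace]] by simp
  then show "0 \<in> \<psi> ` T" using csubspace_0[OF T_csubspace] by force
qed (use \<psi>_clinear csubspaceD[OF T_csubspace] in \<open>auto simp: clinear_on_def image_iff, metis+\<close>)

lemma closed_range_\<psi>: "closed (\<psi> ` T)"
  unfolding closed_sequential_limits
proof (intro allI impI, elim conjE)
  fix f y assume f: "\<forall>n. f n \<in> \<psi> ` T" and lim: "f \<longlonglongrightarrow> y"
  then obtain x where x: "\<And>n. x n \<in> T" "\<And>n. f n = \<psi> (x n)" unfolding image_iff by metis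
  have "Cauchy x"
    using LIMSEQ_imp_Cauchy[OF lim] by (simp add: Cauchy_def x dist_\<psi>)
  then obtain l where l: "x \<longlonglongrightarrow> l" using Cauchy_convergent convergent_def by blast
  then have lT: "l \<in> T" by (intro closed_sequentially[OF T_closed x(1)])
  have "(\<lambda>n. \<psi> (x n)) \<longlonglongrightarrow> \<psi> l"
    using \<psi>_continuous_on l lT x(1) by (auto simp: continuous_on_sequentially o_def)
  then have "y = \<psi> l" using lim x(2) by (metis LIMSEQ_unique ext)
  then show "y \<in> \<psi> ` T" using lT by blast
qed

lemma triple_system_range_\<psi>: "triple_system (\<psi> ` T)"
  unfolding triple_system_def
proof (intro conjI csubspace_range_\<psi> closed_range_\<psi> ballI)
  fix x y z assume "x \<in> \<psi> ` T" "y \<in> \<psi> ` T" "z \<in> \<psi> ` T"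
  then obtain x' y' z' where "x' \<in> T" "y' \<in> T" "z' \<in> T" "x = \<psi> x'" "y = \<psi> y'" "z = \<psi> z'" by blast
  then show "x o\<^sub>L adj y o\<^sub>L z \<in> \<psi> ` T"
    using triple_morphism_triple[OF \<psi>_triple_morphism, of x' y' z'] T_triple[of x' y' z'] by (metis imageI)
qed auto

lemma left_ideal_range_\<psi>: "left_ideal (left_cstar T) (\<psi> ` T)"
  unfolding left_ideal_def
proof (intro conjI csubspace_range_\<psi> closed_range_\<psi> ballI)
  show "\<psi> ` T \<subseteq> left_cstar T" using \<psi>_in_left_cstar by blast
  fix c v assume c: "c \<in> left_cstar T" and "v \<in> \<psi> ` T"
  then obtain z where z: "z \<in> T" "v = \<psi> z" by blast
  have "left_cstar T \<subseteq> (\<lambda>c. c o\<^sub>L v) -` (\<psi> ` T)"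
    unfolding left_cstar_def op_prod_adj
  proof (rule closure_minimal)
    show "closed ((\<lambda>c. c o\<^sub>L v) -` (\<psi> ` T))"
      by (intro continuous_closed_vimage closed_range_\<psi>) (intro continuous_intros)
    show "{\<Sum>m<n. x m o\<^sub>L adj (y m) | (n::nat) x y. \<forall>m<n. x m \<in> T \<and> y m \<in> T} \<subseteq> (\<lambda>c. c o\<^sub>L v) -` (\<psi> ` T)"
    proof (clarsimp)
      fix n :: nat and x y
      assume xy: "\<forall>m<n. x m \<in> T \<and> y m \<in> T"
      have "(\<Sum>m<n. x m o\<^sub>L adj (y m)) o\<^sub>L v = (\<Sum>m<n. x m o\<^sub>L adj (y m) o\<^sub>L v)"
        by (rule bounded_bilinear.sum_left[OF bounded_bilinear_blinfun_compose])
      also have "\<dots> \<in> \<psi> ` T"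
      proof (rule csubspace_sum[OF csubspace_range_\<psi>])
        fix m assume "m < n"
        then have "x m o\<^sub>L adj (y m) o\<^sub>L v = \<psi> (x m o\<^sub>L adj (y m) o\<^sub>L z)"
          using xy z by (simp add: \<psi>_left_module)
        then show "x m o\<^sub>L adj (y m) o\<^sub>L v \<in> \<psi> ` T" using xy z \<open>m < n\<close> T_triple by auto
      qed
      finally show "(\<Sum>m<n. x m o\<^sub>L adj (y m)) o\<^sub>L v \<in> \<psi> ` T" .
    qed
  qed
  then show "c o\<^sub>L v \<in> \<psi> ` T" using c by blast
qed

lemma left_cstar_range_\<psi>: "op_prod (\<psi> ` T) (adj ` \<psi> ` T) = left_cstar T"
proof -
  have "{\<Sum>m<n. x m o\<^sub>L adj (y m) | (n::nat) x y. \<forall>m<n. x m \<in> \<psi> ` T \<and> y m \<in> \<psi> ` T}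
      = {\<Sum>m<n. x m o\<^sub>L adj (y m) | (n::nat) x y. \<forall>m<n. x m \<in> T \<and> y m \<in> T}" (is "?L = ?R")
  proof
    show "?L \<subseteq> ?R"
    proof clarify
      fix n :: nat and x y
      assume "\<forall>m<n. x m \<in> \<psi> ` T \<and> y m \<in> \<psi> ` T"
      then have "\<forall>m. \<exists>u v. m < n \<longrightarrow> u \<in> T \<and> v \<in> T \<and> x m = \<psi> u \<and> y m = \<psi> v" by blast
      then obtain x' y' where "\<And>m. m < n \<Longrightarrow> x' m \<in> T \<and> y' m \<in> T \<and> x m = \<psi> (x' m) \<and> y m = \<psi> (y' m)"
        by metis
      then show "\<exists>(n' :: nat) x' y'. (\<Sum>m<n. x m o\<^sub>L adj (y m)) = (\<Sum>m<n'. x' m o\<^sub>L adj (y' m)) \<and>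
          (\<forall>m<n'. x' m \<in> T \<and> y' m \<in> T)"
        by - (rule exI[of _ n], rule exI[of _ x'], rule exI[of _ y'],
            simp add: \<psi>_compose_adj cong: sum.cong_simp)
    qed
    show "?R \<subseteq> ?L"
    proof clarify
      fix n :: nat and x y
      assume "\<forall>m<n. x m \<in> T \<and> y m \<in> T"
      then show "\<exists>(n' :: nat) x' y'. (\<Sum>m<n. x m o\<^sub>L adj (y m)) = (\<Sum>m<n'. x' m o\<^sub>L adj (y' m)) \<and>
          (\<forall>m<n'. x' m \<in> \<psi> ` T \<and> y' m \<in> \<psi> ` T)"
        by (intro exI[of _ n] exI[of _ "\<lambda>m. \<psi> (x m)"] exI[of _ "\<lambda>m. \<psi> (y m)"]) 
            (simp add: \<psi>_compose_adj cong: sum.cong_simp)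
    qed
  qed
  then show ?thesis by (simp add: left_cstar_def op_prod_adj)
qed

lemma \<psi>_vimage:
  assumes "csubspace B" "closed B"
  shows "csubspace {x \<in> T. \<psi> x \<in> B}" and "closed {x \<in> T. \<psi> x \<in> B}"
proof -
  have "\<psi> 0 = 0" using \<psi>_diff[OF csubspace_0[OF T_csubspace] csubspace_0[OF T_csubspace]] by simp
  then show "csubspace {x \<in> T. \<psi> x \<in> B}"
    using assms(1) T_csubspace \<psi>_clinear by (simp add: csubspace_iff clinear_on_def)
  have "{x \<in> T. \<psi> x \<in> B} = \<psi> -` B \<inter> T" by blast
  then show "closed {x \<in> T. \<psi> x \<in> B}"
    using \<psi>_continuous_on continuous_on_closed_vimage[OF T_closed] assms(2) by metis
qed

lemma triple_extension_range_\<psi>: "triple_extension N (\<psi> ` T) (\<lambda>a. \<psi> (i a))"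
  unfolding triple_extension_def
proof (intro conjI triple_system_range_\<psi> allI impI)
  show "range (\<lambda>a. \<psi> (i a)) \<subseteq> \<psi> ` T" using i_T by blast
  show "clinear_on UNIV (\<lambda>a. \<psi> (i a))"
    using triple_extension_clinear[OF T_ext] \<psi>_clinear i_T by (simp add: clinear_on_def)
  show "complete_isometry UNIV N op_mnorm (\<lambda>a. \<psi> (i a))"
    using triple_extension_isometry[OF T_ext] \<psi>_complete_isometry i_T
    by (simp add: complete_isometry_def)
  fix W assume W: "triple_subspace (\<psi> ` T) W \<and> range (\<lambda>a. \<psi> (i a)) \<subseteq> W"
  then have W_sys: "triple_system W" by (simp add: triple_subspace_def)
  have "\<psi> x \<in> W" if "x \<in> T" for x
  proof (rule triple_extension_induct[OF T_ext that])
    show "\<psi> (i a) \<in> W" for a using W by blast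
    fix x y z assume "x \<in> T" "y \<in> T" "z \<in> T" "\<psi> x \<in> W" "\<psi> y \<in> W" "\<psi> z \<in> W"
    then show "\<psi> (x o\<^sub>L adj y o\<^sub>L z) \<in> W"
      by (simp add: triple_morphism_triple[OF \<psi>_triple_morphism] triple_system_triple[OF W_sys])
  qed (intro \<psi>_vimage triple_system_csubspace[OF W_sys] triple_system_closed[OF W_sys])+
  then show "W = \<psi> ` T" using W by (auto simp: triple_subspace_def)
qed

lemma triple_envelope_wrt_range_\<psi>:
  assumes "triple_envelope_wrt TYPE('p::chilbert) TYPE('q::chilbert) N T i"
  shows "triple_envelope_wrt TYPE('p) TYPE('q) N (\<psi> ` T) (\<lambda>a. \<psi> (i a))"
  unfolding triple_envelope_wrt_def
proof (intro conjI triple_extension_range_\<psi> allI impI)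
  fix Y :: "('p \<Rightarrow>\<^sub>L 'q) set" and k assume "triple_extension N Y k"
  then obtain \<sigma> where "triple_morphism Y T \<sigma>" "\<forall>a. \<sigma> (k a) = i a"
    using assms unfolding triple_envelope_wrt_def by blast
  then show "\<exists>\<sigma>. triple_morphism Y (\<psi> ` T) \<sigma> \<and> (\<forall>a. \<sigma> (k a) = \<psi> (i a))"
    using triple_morphism_compose[OF _ \<psi>_triple_morphism] by (intro exI[of _ "\<lambda>x. \<psi> (\<sigma> x)"]) simp
qed

lemma right_cai_range_\<psi>:
  assumes e': "right_cai (*) (\<lambda>a. N 1 (\<lambda>_ _. a)) UNIV e' F'"
  shows "right_cai (o\<^sub>L) norm (\<psi> ` T) (\<lambda>\<alpha>. \<psi> (i (e' \<alpha>))) F'"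
proof -
  have n: "norm (\<psi> (i (e' \<alpha>))) \<le> 1" for \<alpha>
    using e' by (simp add: norm_\<psi> i_T triple_extension_norm[OF T_ext] right_cai_def)
  have "((\<lambda>\<alpha>. \<psi> x o\<^sub>L \<psi> (i (e' \<alpha>))) \<longlongrightarrow> \<psi> x) F'" if "x \<in> T" for x
  proof (rule triple_extension_induct[OF T_ext that])
    fix a
    have lim: "((\<lambda>\<alpha>. \<theta> (\<rho> (a * e' \<alpha>))) \<longlongrightarrow> \<theta> (\<rho> a)) F'"
      using \<rho>_right_cai[OF e', of a] by (intro \<theta>_tendsto \<rho>_Z) (simp add: mult)
    have "((\<lambda>\<alpha>. \<psi> (i (a * e' \<alpha>))) \<longlongrightarrow> \<psi> (i a)) F'"
      by (rule continuous_on_tendsto_compose[OF \<psi>_continuous_on lim[unfolded \<theta>_\<rho>] i_T])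
        (simp add: i_T)
    then show "((\<lambda>\<alpha>. \<psi> (i a) o\<^sub>L \<psi> (i (e' \<alpha>))) \<longlongrightarrow> \<psi> (i a)) F'" by (simp add: \<psi>_i_mult)
  next
    note B = csubspace_approximated closed_approximated[of "\<lambda>\<alpha>. \<psi> (i (e' \<alpha>))", OF n]
    show "csubspace {x \<in> T. ((\<lambda>\<alpha>. \<psi> x o\<^sub>L \<psi> (i (e' \<alpha>))) \<longlongrightarrow> \<psi> x) F'}"
      using \<psi>_vimage(1)[OF B] by simp
    show "closed {x \<in> T. ((\<lambda>\<alpha>. \<psi> x o\<^sub>L \<psi> (i (e' \<alpha>))) \<longlongrightarrow> \<psi> x) F'}"
      using \<psi>_vimage(2)[OF B] by simp
  next
    fix x y z assume xyz: "x \<in> T" "y \<in> T" "z \<in> T"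
      and "((\<lambda>\<alpha>. \<psi> z o\<^sub>L \<psi> (i (e' \<alpha>))) \<longlongrightarrow> \<psi> z) F'"
    then show "((\<lambda>\<alpha>. \<psi> (x o\<^sub>L adj y o\<^sub>L z) o\<^sub>L \<psi> (i (e' \<alpha>))) \<longlongrightarrow> \<psi> (x o\<^sub>L adj y o\<^sub>L z)) F'"
      using tendsto_compose_op[OF tendsto_const[of "x o\<^sub>L adj y"]]
      unfolding \<psi>_left_module[OF xyz] by (simp add: compose_assoc)
  qed
  then have "((\<lambda>\<alpha>. norm ((v o\<^sub>L \<psi> (i (e' \<alpha>))) - v)) \<longlongrightarrow> 0) F'" if "v \<in> \<psi> ` T" for v
    using that by (auto simp: LIM_zero tendsto_norm_zero)
  then show ?thesis
    using e' n i_T by (simp add: right_cai_def)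
qed

end

lemma triple_extension_hull:
  assumes "range \<rho> \<subseteq> bounded_ops" "clinear_on UNIV \<rho>" "complete_isometry UNIV N op_mnorm \<rho>"
  shows "triple_extension N (triple_system hull (range \<rho>)) \<rho>"
  unfolding triple_extension_def
proof (intro conjI triple_system_hull assms hull_subset allI impI)
  show "W = triple_system hull (range \<rho>)"
    if "triple_subspace (triple_system hull (range \<rho>)) W \<and> range \<rho> \<subseteq> W" for W
    using that hull_minimal[of "range \<rho>" W triple_system] by (auto simp: triple_subspace_def)
qed

theorem theorem2p3:
  fixes N :: "nat \<Rightarrow> (nat \<Rightarrow> nat \<Rightarrow> 'a::complex_algebra) \<Rightarrow> real"
    and e :: "'d \<Rightarrow> 'a" and F :: "'d filter"
    and T :: "('k::chilbert \<Rightarrow>\<^sub>L 'h::chilbert) set" and i :: "'a \<Rightarrow> ('k \<Rightarrow>\<^sub>L 'h)"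
    and E J :: "('h \<Rightarrow>\<^sub>L 'h) set"
    and \<psi> :: "('k \<Rightarrow>\<^sub>L 'h) \<Rightarrow> ('h \<Rightarrow>\<^sub>L 'h)" and j :: "'a \<Rightarrow> ('h \<Rightarrow>\<^sub>L 'h)"
  assumes "operator_algebra TYPE('g::chilbert) N"
    and "right_cai (*) (\<lambda>a. N 1 (\<lambda>_ _. a)) UNIV e F"
    and "triple_envelope N T i"
    and "E = left_cstar T"
    and "\<psi> = (\<lambda>x. Lim F (\<lambda>\<alpha>. x o\<^sub>L adj (i (e \<alpha>))))"
    and "j = \<psi> \<circ> i"
    and "J = \<psi> ` T"
  shows "(\<forall>x\<in>T. ((\<lambda>\<alpha>. x o\<^sub>L adj (i (e \<alpha>))) \<longlongrightarrow> \<psi> x) F \<and> \<psi> x \<in> E)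
    \<and> clinear_on T \<psi> \<and> complete_isometry T op_mnorm op_mnorm \<psi>
    \<and> clinear_on UNIV j \<and> (\<forall>a b. j (a * b) = j a o\<^sub>L j b)
    \<and> left_ideal E J
    \<and> triple_morphism T J \<psi>
    \<and> triple_envelope N J j
    \<and> triple_envelope_wrt TYPE('p::chilbert) TYPE('q::chilbert) N J j
    \<and> op_prod J (adj ` J) = E
    \<and> (\<forall>(e' :: 'c \<Rightarrow> 'a) F'. right_cai (*) (\<lambda>a. N 1 (\<lambda>_ _. a)) UNIV e' F' \<longrightarrow>
         right_cai (o\<^sub>L) norm J (\<lambda>\<alpha>. j (e' \<alpha>)) F')
    \<and> (\<forall>x\<in>T. \<forall>y\<in>T. \<psi> x o\<^sub>L adj (\<psi> y) = x o\<^sub>L adj y)"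
proof -
  obtain \<rho> :: "'a \<Rightarrow> ('g \<Rightarrow>\<^sub>L 'g)"
    where \<rho>: "range \<rho> \<subseteq> bounded_ops" "clinear_on UNIV \<rho>" "\<And>a b. \<rho> (a * b) = \<rho> a o\<^sub>L \<rho> b"
      "complete_isometry UNIV N op_mnorm \<rho>"
    using assms(1) unfolding operator_algebra_def by blast
  define Z where "Z = triple_system hull (range \<rho>)"
  have Z: "triple_extension N Z \<rho>"
    unfolding Z_def by (rule triple_extension_hull[OF \<rho>(1,2,4)])
  have T: "triple_extension N T i" using assms(3) by (simp add: triple_envelope_wrt_def)
  obtain \<theta> where \<theta>: "triple_morphism Z T \<theta>" "\<And>a. \<theta> (\<rho> a) = i a"
    using triple_envelope_imp_wrt[OF assms(3), where 'p = 'g and 'q = 'g] Z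
    unfolding triple_envelope_wrt_def by blast
  interpret R: represented_triple_extension N Z \<rho> T i \<theta> e F
    by unfold_locales (use Z T \<rho>(3) \<theta> assms(2) in auto)
  have \<psi>: "\<psi> = R.\<psi>" by (rule ext) (simp add: assms(5) R.\<psi>_def)
  have j: "j = (\<lambda>a. R.\<psi> (i a))" by (simp add: assms(6) \<psi> o_def)
  show ?thesis
    unfolding assms(4) assms(7) j \<psi>
    using R.\<psi>_tendsto R.\<psi>_in_left_cstar R.\<psi>_clinear R.\<psi>_complete_isometry
      triple_extension_clinear[OF R.triple_extension_range_\<psi>] R.\<psi>_i_mult R.left_ideal_range_\<psi>
      R.\<psi>_triple_morphism R.triple_envelope_wrt_range_\<psi>[OF assms(3)]
      R.triple_envelope_wrt_range_\<psi>[OF triple_envelope_imp_wrt[OF assms(3), where 'p = 'p and 'q = 'q]]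
      R.left_cstar_range_\<psi> R.right_cai_range_\<psi> R.\<psi>_compose_adj
    by (intro conjI allI ballI impI)
qed

end
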